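(* Let $P_1,\ldots,P_s$ be distinct points in $\mathbb{P}^n$, let $m_1,\ldots,m_s$ be positive integers, and let $Z=m_1P_1+\cdots+m_sP_s$ be the corresponding set of fat points in $\mathbb{P}^n$. Then $$\operatorname{reg}(Z)\ \ge\ \max\{D_j \mid j=1,\ldots,n\},$$ where $$D_j=\max\left\{\left[\frac{\sum_{l=1}^q m_{i_l}+j-2}{j}\right]\ \Big|\ P_{i_1},\ldots,P_{i_q}\text{ are in Rnc-}j\right\},$$ the maximum being taken over all nonempty subsets $\{P_{i_1},\ldots,P_{i_q}\}$ (with $i_1,\ldots,i_q$ distinct) of $\{P_1,\ldots,P_s\}$ that are in Rnc-$j$ in $\mathbb{P}^n$.
   Context: $K$ is an algebraically closed field, $\mathbb{P}^n=\mathbb{P}^n(K)$, and $R=K[X_0,\ldots,X_n]$. For distinct points $P_1,\ldots,P_s$ of $\mathbb{P}^n$, $\wp_i\subset R$ is the homogeneous prime ideal of $P_i$. For positive integers $m_1,\ldots,m_s$, the set of fat points $Z=m_1P_1+\cdots+m_sP_s$ is the zero-scheme defined by $I=\wp_1^{m_1}\cap\cdots\cap\wp_s^{m_s}$. The Hilbert function $H_{R/I}(t)=\dim_K(R/I)_t$ strictly increases until it reaches the multiplicity $e(R/I)=\sum_{i=1}^s\binom{m_i+n-1}{n}$, at which it stabilizes. The regularity index $\operatorname{reg}(Z)=\operatorname{reg}(R/I)$ is the least integer $t$ such that $H_{R/I}(t)=e(R/I)$ (it equals the Castelnuovo–Mumford regularity of $R/I$). For $1\le j\le n$, distinct points $Q_1,\ldots,Q_r$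 of $\mathbb{P}^n$ are said to be in Rnc-$j$ in $\mathbb{P}^n$ if there is a linear change of coordinates $\varphi$ of $\mathbb{P}^n$ such that the coordinates of each of $\varphi(Q_1),\ldots,\varphi(Q_r)$ satisfy the parametric equations $X_0=t^j,\ X_1=t^{j-1}u,\ \ldots,\ X_{j-1}=tu^{j-1},\ X_j=u^j,\ X_{j+1}=0,\ldots,X_n=0$ (for some parameter value $(t,u)\neq(0,0)$ depending on the point). For a rational number $x$, $[x]$ denotes its integer part. *)

theory Defs
  imports
    "HOL-Library.Poly_Mapping"
    "HOL-Computational_Algebra.Polynomial"
    "HOL-Algebra.Ideal_Product"
    "HOL-Algebra.QuotRing"
    "HOL-Algebra.Embedded_Algebras"
    "Jordan_Normal_Form.Matrix"
begin

text \<open>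
  A polynomial is a finitely supported map from exponent vectors to coefficients; the exponent
  vectors are themselves finitely supported on the variable indices.
  The variables available in \<open>mpoly_ring n\<close> are those with index \<open>0, \<dots>, n\<close>.
\<close>

type_synonym 'a mpoly = "(nat \<Rightarrow>\<^sub>0 nat) \<Rightarrow>\<^sub>0 'a"

definition mpoly_ring :: "nat \<Rightarrow> 'a::comm_ring_1 mpoly ring" where
  "mpoly_ring n =
     \<lparr> carrier = {f. \<forall>\<alpha> \<in> Poly_Mapping.keys f. Poly_Mapping.keys \<alpha> \<subseteq> {..n}},
       mult = (*), one = 1, zero = 0, add = (+) \<rparr>"

definition monom_degree :: "(nat \<Rightarrow>\<^sub>0 nat) \<Rightarrow> nat" where
  "monom_degree \<alpha> = (\<Sum>i \<in> Poly_Mapping.keys \<alpha>. Poly_Mapping.lookup \<alpha> i)"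

text \<open>The graded component of degree \<open>t\<close>; it contains the zero polynomial.\<close>

definition forms :: "nat \<Rightarrow> nat \<Rightarrow> 'a::comm_ring_1 mpoly set" where
  "forms n t = {f \<in> carrier (mpoly_ring n). \<forall>\<alpha> \<in> Poly_Mapping.keys f. monom_degree \<alpha> = t}"

definition constants :: "'a::comm_ring_1 mpoly set" where
  "constants = range (Poly_Mapping.single 0)"

definition mpoly_eval :: "'a::comm_ring_1 mpoly \<Rightarrow> 'a vec \<Rightarrow> 'a" where
  "mpoly_eval f v =
     (\<Sum>\<alpha> \<in> Poly_Mapping.keys f. Poly_Mapping.lookup f \<alpha> *
        (\<Prod>i \<in> Poly_Mapping.keys \<alpha>. (v $ i) ^ Poly_Mapping.lookup \<alpha> i))"

text \<open>
  A point is the set of all its homogeneous coordinate vectors, i.e. an equivalence class of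
  nonzero vectors of length \<open>n + 1\<close> under proportionality.
\<close>

definition proportional :: "nat \<Rightarrow> ('a::field vec \<times> 'a vec) set" where
  "proportional n =
     {(v, w). v \<in> carrier_vec (n + 1) - {0\<^sub>v (n + 1)} \<and> w \<in> carrier_vec (n + 1) - {0\<^sub>v (n + 1)} \<and>
              (\<exists>c. c \<noteq> 0 \<and> w = c \<cdot>\<^sub>v v)}"

definition proj_space :: "nat \<Rightarrow> 'a::field vec set set" where
  "proj_space n = (carrier_vec (n + 1) - {0\<^sub>v (n + 1)}) // proportional n"

definition rnc_vec :: "nat \<Rightarrow> nat \<Rightarrow> 'a::field \<Rightarrow> 'a \<Rightarrow> 'a vec" where
  "rnc_vec n j t u = vec (n + 1) (\<lambda>i. if i \<le> j then t ^ (j - i) * u ^ i else 0)"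

text \<open>
  The linear change of coordinates is given by an invertible matrix; it sends the point \<open>Q\<close> to the
  image of \<open>Q\<close>, regarded as a set of coordinate vectors.
\<close>

definition in_Rnc :: "nat \<Rightarrow> nat \<Rightarrow> 'a::field vec set set \<Rightarrow> bool" where
  "in_Rnc n j S \<longleftrightarrow>
     (\<exists>A \<in> carrier_mat (n + 1) (n + 1). invertible_mat A \<and>
        (\<forall>Q \<in> S. \<exists>t u. (t, u) \<noteq> (0, 0) \<and> rnc_vec n j t u \<in> (\<lambda>v. A *\<^sub>v v) ` Q))"

definition point_ideal :: "nat \<Rightarrow> 'a::field vec set \<Rightarrow> 'a mpoly set" where
  "point_ideal n Q =
     genideal (mpoly_ring n) {f. (\<exists>d. f \<in> forms n d) \<and> (\<forall>v \<in> Q. mpoly_eval f v = 0)}"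

text \<open>Meaningful for \<open>s \<ge> 1\<close> only: the empty intersection would be \<open>UNIV\<close>.\<close>

definition fat_ideal :: "nat \<Rightarrow> nat \<Rightarrow> (nat \<Rightarrow> 'a::field vec set) \<Rightarrow> (nat \<Rightarrow> nat) \<Rightarrow> 'a mpoly set" where
  "fat_ideal n s P m =
     (\<Inter>i \<in> {1..s}. point_ideal n (P i) [^]\<^bsub>ideals_set (mpoly_ring n)\<^esub> m i)"

text \<open>
  The degree \<open>t\<close> component of \<open>R/I\<close> is the image of the forms of degree \<open>t\<close>; its dimension is taken
  over the copy of the ground field in \<open>R/I\<close>.
\<close>

definition hilbert_fun :: "nat \<Rightarrow> 'a::field mpoly set \<Rightarrow> nat \<Rightarrow> nat" where
  "hilbert_fun n I t =
     ring.dim (mpoly_ring n Quot I)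
       ((\<lambda>c. I +>\<^bsub>mpoly_ring n\<^esub> c) ` constants)
       ((\<lambda>f. I +>\<^bsub>mpoly_ring n\<^esub> f) ` forms n t)"

definition fat_multiplicity :: "nat \<Rightarrow> nat \<Rightarrow> (nat \<Rightarrow> nat) \<Rightarrow> nat" where
  "fat_multiplicity n s m = (\<Sum>i = 1..s. (m i + n - 1) choose n)"

definition fat_reg :: "nat \<Rightarrow> nat \<Rightarrow> (nat \<Rightarrow> 'a::field vec set) \<Rightarrow> (nat \<Rightarrow> nat) \<Rightarrow> nat" where
  "fat_reg n s P m = (LEAST t. hilbert_fun n (fat_ideal n s P m) t = fat_multiplicity n s m)"

text \<open>
  For \<open>s \<ge> 1\<close> and \<open>1 \<le> j \<le> n\<close> the maximum is over a nonempty finite set, since any single point is in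
  Rnc-\<open>j\<close>.
\<close>

definition rnc_bound :: "nat \<Rightarrow> nat \<Rightarrow> (nat \<Rightarrow> 'a::field vec set) \<Rightarrow> (nat \<Rightarrow> nat) \<Rightarrow> nat \<Rightarrow> int" where
  "rnc_bound n s P m j =
     Max {\<lfloor>(of_nat (\<Sum>i \<in> T. m i) + of_nat j - 2 :: rat) / of_nat j\<rfloor> | T.
            T \<subseteq> {1..s} \<and> T \<noteq> {} \<and> in_Rnc n j (P ` T)}"

end

theory Submission
  imports Defs "HOL-Library.Function_Algebras"
begin

text \<open>
  Choose for each \<open>P\<^sub>i\<close> a coordinate vector with some coordinate equal to \<open>1\<close>; a form lies in
  \<open>\<wp>\<^sub>i\<^bsup>m\<^esup>\<close> iff its expansion in affine coordinates at \<open>P\<^sub>i\<close> has no terms of order below \<open>m\<close>.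
  So \<open>(R/I)\<^sub>t\<close> embeds, via these truncated expansions (jets), in a space of dimension \<open>e(R/I)\<close>, and
  \<open>H(t) = e(R/I)\<close> says exactly that every prescription of jets is realised by a form of degree \<open>t\<close>.
  This holds for \<open>t = \<Sum> m\<^sub>i\<close>, so the regularity index is attained. At \<open>t = reg(Z)\<close>, given points
  \<open>P\<^sub>i\<close>, \<open>i \<in> T\<close>, on a rational normal curve of degree \<open>j\<close>, fix \<open>k \<in> T\<close> and take a form \<open>F\<close> of degree
  \<open>t\<close> with zero jets at the other points and jet \<open>y\<^bsup>m\<^sub>k - 1\<^esup>\<close> at \<open>P\<^sub>k\<close>, where \<open>y\<close> is a local coordinate
  not tangent to the curve. Restricted to the curve, \<open>F\<close> is a nonzero polynomial of degree at
  most \<open>t j\<close> with at least \<open>\<Sum>\<^sub>T m\<^sub>i - 1\<close> zeros.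
\<close>

section \<open>Substitution into polynomials\<close>

text \<open>Everything happens inside Z itself: F has zero jets at every point other than
  \<open>P k\<close>, whether it lies in T or not, so reg(Z) is never compared with the regularity
  of the subscheme supported on T. The delicate point is that the restriction of F to the curve must
  not vanish identically, and this is why one zero is given up at \<open>P k\<close>. Modulo the
  m_k-th power of the ideal of \<open>P k\<close>, F agrees with a single monomial y^(m_k - 1)
  X_c^(t - m_k + 1) in local coordinates; along the curve y has a simple zero at \<open>P k\<close>
  and X_c has none, so the restriction has order exactly m_k - 1 there. The inequality sum m_i - 1
  <= t j accounts for the -2 in D_j: it gives sum m_i + j - 2 <= t j + j - 1 < (t + 1) j. Powers of
  \<wp> are made computable twice, by orders at a point and by multiplicities along the curve; both
  are instances of one statement about a ring map into a filtered ring, to be checked on generators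
  only.\<close>

definition monom_eval :: "(nat \<Rightarrow> 'b::comm_ring_1) \<Rightarrow> (nat \<Rightarrow>\<^sub>0 nat) \<Rightarrow> 'b" where
  "monom_eval \<phi> \<alpha> = (\<Prod>i\<in>Poly_Mapping.keys \<alpha>. \<phi> i ^ Poly_Mapping.lookup \<alpha> i)"

text \<open>The coefficient map \<open>h\<close> lets one notion serve three purposes: evaluation at
  a vector (identity), change of variables (\<open>Poly_Mapping.single 0\<close>) and restriction to
  a parametrised curve (constants of K[x]).\<close>

definition subst :: "('a::comm_ring_1 \<Rightarrow> 'b::comm_ring_1) \<Rightarrow> (nat \<Rightarrow> 'b) \<Rightarrow> 'a mpoly \<Rightarrow> 'b" where
  "subst h \<phi> f = (\<Sum>\<alpha>\<in>Poly_Mapping.keys f. h (Poly_Mapping.lookup f \<alpha>) * monom_eval \<phi> \<alpha>)"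

definition mvar :: "nat \<Rightarrow> 'a::comm_ring_1 mpoly" where
  "mvar i = Poly_Mapping.single (Poly_Mapping.single i 1) 1"

lemma mpoly_eval_eq_subst: "mpoly_eval f v = subst (\<lambda>x. x) (($) v) f"
  by (simp add: mpoly_eval_def subst_def monom_eval_def)

lemma monom_eval_superset:
  assumes "finite S" "Poly_Mapping.keys \<alpha> \<subseteq> S"
  shows "monom_eval \<phi> \<alpha> = (\<Prod>i\<in>S. \<phi> i ^ Poly_Mapping.lookup \<alpha> i)"
  unfolding monom_eval_def using assms
  by (intro prod.mono_neutral_left) (auto simp: in_keys_iff)

lemma keys_add_nat:
  "Poly_Mapping.keys (\<alpha> + \<beta> :: nat \<Rightarrow>\<^sub>0 nat) = Poly_Mapping.keys \<alpha> \<union> Poly_Mapping.keys \<beta>"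
  by (auto simp: in_keys_iff lookup_add)

lemma monom_eval_add: "monom_eval \<phi> (\<alpha> + \<beta>) = monom_eval \<phi> \<alpha> * monom_eval \<phi> \<beta>"
proof -
  let ?S = "Poly_Mapping.keys \<alpha> \<union> Poly_Mapping.keys \<beta>"
  have "monom_eval \<phi> \<gamma> = (\<Prod>i\<in>?S. \<phi> i ^ Poly_Mapping.lookup \<gamma> i)"
    if "Poly_Mapping.keys \<gamma> \<subseteq> ?S" for \<gamma>
    using that by (intro monom_eval_superset) auto
  then show ?thesis
    by (simp add: keys_add_nat lookup_add power_add prod.distrib)
qed

lemma monom_eval_0 [simp]: "monom_eval \<phi> 0 = 1"
  by (simp add: monom_eval_def)

lemma monom_eval_single [simp]: "monom_eval \<phi> (Poly_Mapping.single i k) = \<phi> i ^ k"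
  by (simp add: monom_eval_def)

lemma poly_mapping_sum_single:
  "f = (\<Sum>\<alpha>\<in>Poly_Mapping.keys f. Poly_Mapping.single \<alpha> (Poly_Mapping.lookup f \<alpha>))"
  by (rule poly_mapping_eqI) (auto simp: lookup_sum lookup_single when_def in_keys_iff)

context comm_ring_hom
begin

lemma subst_superset:
  assumes "finite S" "Poly_Mapping.keys f \<subseteq> S"
  shows "subst hom \<phi> f = (\<Sum>\<alpha>\<in>S. hom (Poly_Mapping.lookup f \<alpha>) * monom_eval \<phi> \<alpha>)"
  unfolding subst_def using assms
  by (intro sum.mono_neutral_left) (auto simp: in_keys_iff)

lemma subst_add: "subst hom \<phi> (f + g) = subst hom \<phi> f + subst hom \<phi> g"
proof -
  let ?S = "Poly_Mapping.keys f \<union> Poly_Mapping.keys g"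
  have "subst hom \<phi> q = (\<Sum>\<alpha>\<in>?S. hom (Poly_Mapping.lookup q \<alpha>) * monom_eval \<phi> \<alpha>)"
    if "Poly_Mapping.keys q \<subseteq> ?S" for q
    using that by (intro subst_superset) auto
  from this[of f] this[of g] this[of "f + g"] show ?thesis
    using Poly_Mapping.keys_add[of f g]
    by (simp add: lookup_add hom_add distrib_right sum.distrib)
qed

lemma subst_0 [simp]: "subst hom \<phi> 0 = 0"
  by (simp add: subst_def)

lemma subst_single [simp]:
  "subst hom \<phi> (Poly_Mapping.single \<alpha> c) = hom c * monom_eval \<phi> \<alpha>"
  by (simp add: subst_def)

lemma subst_sum: "subst hom \<phi> (sum g A) = (\<Sum>a\<in>A. subst hom \<phi> (g a))"
  by (induction A rule: infinite_finite_induct) (auto simp: subst_add)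

lemma subst_mult: "subst hom \<phi> (f * g) = subst hom \<phi> f * subst hom \<phi> g"
proof -
  have *: "f * g = (\<Sum>\<alpha>\<in>Poly_Mapping.keys f. \<Sum>\<beta>\<in>Poly_Mapping.keys g.
      Poly_Mapping.single (\<alpha> + \<beta>) (Poly_Mapping.lookup f \<alpha> * Poly_Mapping.lookup g \<beta>))"
    by (subst poly_mapping_sum_single[of f], subst poly_mapping_sum_single[of g])
       (simp add: sum_product mult_single)
  show ?thesis
    unfolding * subst_sum subst_single
    unfolding subst_def sum_product by (simp add: monom_eval_add hom_mult mult_ac)
qed

lemma comm_ring_hom_subst: "comm_ring_hom (subst hom \<phi>)"
proof
  show "subst hom \<phi> 1 = 1"
    using subst_single[of \<phi> 0 1] by simp
qed (auto simp: subst_add subst_mult)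

lemma subst_mvar [simp]: "subst hom \<phi> (mvar i) = \<phi> i"
  by (simp add: mvar_def)

lemma subst_const: "subst hom \<phi> (Poly_Mapping.single 0 c) = hom c"
  by simp

end

lemma comm_ring_hom_const: "comm_ring_hom (Poly_Mapping.single 0 :: 'a::comm_ring_1 \<Rightarrow> 'a mpoly)"
  by standard (auto simp: single_add mult_single)

lemma comm_ring_hom_ident: "comm_ring_hom (\<lambda>x::'a::comm_ring_1. x)"
  by standard auto

lemma comm_ring_hom_pconst: "comm_ring_hom (\<lambda>c::'a::comm_ring_1. [:c:])"
  by standard (auto simp: one_pCons)

lemma hom_monom_eval:
  assumes "comm_ring_hom H"
  shows "H (monom_eval \<phi> \<alpha>) = monom_eval (\<lambda>i. H (\<phi> i)) \<alpha>"
proof -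
  interpret comm_ring_hom H by fact
  show ?thesis by (simp add: monom_eval_def hom_prod hom_power)
qed

lemma hom_subst:
  assumes "comm_ring_hom H"
  shows "H (subst h \<phi> f) = subst (\<lambda>c. H (h c)) (\<lambda>i. H (\<phi> i)) f"
proof -
  interpret comm_ring_hom H by fact
  show ?thesis
    by (simp add: subst_def hom_sum hom_mult hom_monom_eval[OF assms])
qed

lemma subst_subst:
  assumes "comm_ring_hom h"
  shows "subst h \<chi> (subst (Poly_Mapping.single 0) \<tau> f) = subst h (\<lambda>i. subst h \<chi> (\<tau> i)) f"
proof -
  interpret comm_ring_hom h by fact
  show ?thesis by (subst hom_subst[OF comm_ring_hom_subst]) (simp add: subst_const)
qed

lemma monom_eval_mvar: "monom_eval mvar \<alpha> = Poly_Mapping.single \<alpha> (1::'a::comm_ring_1)"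
proof -
  have pw: "mvar i ^ k = Poly_Mapping.single (Poly_Mapping.single i k) (1::'a)" for i k
    by (induction k) (auto simp: mvar_def mult_single simp flip: single_add)
  have "(\<Prod>i\<in>S. Poly_Mapping.single (Poly_Mapping.single i (Poly_Mapping.lookup \<alpha> i)) (1::'a))
      = Poly_Mapping.single (\<Sum>i\<in>S. Poly_Mapping.single i (Poly_Mapping.lookup \<alpha> i)) 1" for S
    by (induction S rule: infinite_finite_induct) (auto simp: mult_single)
  then show ?thesis
    by (simp add: monom_eval_def pw flip: poly_mapping_sum_single)
qed

lemma subst_id: "subst (Poly_Mapping.single 0) mvar f = (f :: 'a::comm_ring_1 mpoly)"
proof -
  have "subst (Poly_Mapping.single 0) mvar f
      = (\<Sum>\<alpha>\<in>Poly_Mapping.keys f. Poly_Mapping.single \<alpha> (Poly_Mapping.lookup f \<alpha>))"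
    by (simp add: subst_def monom_eval_mvar mult_single)
  then show ?thesis by (simp flip: poly_mapping_sum_single)
qed

section \<open>Degrees and forms\<close>

lemma monom_degree_superset:
  assumes "finite S" "Poly_Mapping.keys \<alpha> \<subseteq> S"
  shows "monom_degree \<alpha> = (\<Sum>i\<in>S. Poly_Mapping.lookup \<alpha> i)"
  unfolding monom_degree_def using assms
  by (intro sum.mono_neutral_left) (auto simp: in_keys_iff)

lemma monom_degree_add: "monom_degree (\<alpha> + \<beta>) = monom_degree \<alpha> + monom_degree \<beta>"
proof -
  let ?S = "Poly_Mapping.keys \<alpha> \<union> Poly_Mapping.keys \<beta>"
  have "monom_degree \<gamma> = (\<Sum>i\<in>?S. Poly_Mapping.lookup \<gamma> i)"
    if "Poly_Mapping.keys \<gamma> \<subseteq> ?S" for \<gamma>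
    using that by (intro monom_degree_superset) auto
  then show ?thesis by (simp add: keys_add_nat lookup_add sum.distrib)
qed

lemma monom_degree_0 [simp]: "monom_degree 0 = 0"
  by (simp add: monom_degree_def)

lemma monom_degree_single [simp]: "monom_degree (Poly_Mapping.single i k) = k"
  by (simp add: monom_degree_def)

lemma mem_carrier_mpoly_ring:
  "f \<in> carrier (mpoly_ring n) \<longleftrightarrow> (\<forall>\<alpha>\<in>Poly_Mapping.keys f. Poly_Mapping.keys \<alpha> \<subseteq> {..n})"
  by (simp add: mpoly_ring_def)

lemma mpoly_ring_simps [simp]:
  "x \<otimes>\<^bsub>mpoly_ring n\<^esub> y = x * y" "x \<oplus>\<^bsub>mpoly_ring n\<^esub> y = x + y"
  "\<one>\<^bsub>mpoly_ring n\<^esub> = 1" "\<zero>\<^bsub>mpoly_ring n\<^esub> = 0"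
  by (auto simp: mpoly_ring_def)

lemma carrier_add:
  "f \<in> carrier (mpoly_ring n) \<Longrightarrow> g \<in> carrier (mpoly_ring n) \<Longrightarrow> f + g \<in> carrier (mpoly_ring n)"
  using Poly_Mapping.keys_add[of f g] by (auto simp: mem_carrier_mpoly_ring)

lemma carrier_mult:
  "f \<in> carrier (mpoly_ring n) \<Longrightarrow> g \<in> carrier (mpoly_ring n) \<Longrightarrow> f * g \<in> carrier (mpoly_ring n)"
  using Poly_Mapping.keys_mult[of f g] by (fastforce simp: mem_carrier_mpoly_ring keys_add_nat)

lemma keys_uminus [simp]: "Poly_Mapping.keys (- f) = Poly_Mapping.keys (f::'b \<Rightarrow>\<^sub>0 'a::ab_group_add)"
  by (auto simp: in_keys_iff)

lemma const_in_carrier: "Poly_Mapping.single 0 c \<in> carrier (mpoly_ring n)"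
  by (simp add: mem_carrier_mpoly_ring)

lemma cring_mpoly_ring: "cring (mpoly_ring n :: 'a::comm_ring_1 mpoly ring)"
proof (rule cringI)
  show "abelian_group (mpoly_ring n :: 'a mpoly ring)"
  proof (rule abelian_groupI)
    fix x :: "'a mpoly" assume "x \<in> carrier (mpoly_ring n)"
    then show "\<exists>y\<in>carrier (mpoly_ring n). y \<oplus>\<^bsub>mpoly_ring n\<^esub> x = \<zero>\<^bsub>mpoly_ring n\<^esub>"
      by (intro bexI[of _ "- x"]) (auto simp: mem_carrier_mpoly_ring)
  qed (auto simp: carrier_add algebra_simps, auto simp: mem_carrier_mpoly_ring)
  show "Group.comm_monoid (mpoly_ring n :: 'a mpoly ring)"
    by (rule comm_monoidI) (auto simp: carrier_mult algebra_simps, auto simp: mem_carrier_mpoly_ring)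
qed (auto simp: algebra_simps)

lemma forms_iff:
  "f \<in> forms n t \<longleftrightarrow>
    (\<forall>\<alpha>\<in>Poly_Mapping.keys f. Poly_Mapping.keys \<alpha> \<subseteq> {..n} \<and> monom_degree \<alpha> = t)"
  by (auto simp: forms_def mem_carrier_mpoly_ring)

lemma forms_in_carrier: "f \<in> forms n t \<Longrightarrow> f \<in> carrier (mpoly_ring n)"
  by (simp add: forms_def)

lemma forms_0 [simp]: "0 \<in> forms n t"
  by (simp add: forms_iff)

lemma forms_add: "f \<in> forms n t \<Longrightarrow> g \<in> forms n t \<Longrightarrow> f + g \<in> forms n t"
  using Poly_Mapping.keys_add[of f g] by (auto simp: forms_iff)

lemma forms_uminus: "f \<in> forms n t \<Longrightarrow> - f \<in> forms n t"
  by (auto simp: forms_iff)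

lemma forms_diff: "f \<in> forms n t \<Longrightarrow> g \<in> forms n t \<Longrightarrow> f - g \<in> forms n t"
  for f g :: "'a::comm_ring_1 mpoly"
  using forms_add[of f n t "- g"] by (simp add: forms_uminus)

lemma forms_mult: "f \<in> forms n s \<Longrightarrow> g \<in> forms n t \<Longrightarrow> f * g \<in> forms n (s + t)"
  using Poly_Mapping.keys_mult[of f g]
  by (fastforce simp: forms_iff keys_add_nat monom_degree_add)

lemma forms_const: "Poly_Mapping.single 0 c \<in> forms n 0"
  by (simp add: forms_iff)

lemma forms_smult: "f \<in> forms n t \<Longrightarrow> Poly_Mapping.single 0 c * f \<in> forms n t"
  using forms_mult[OF forms_const, of f n t c] by simp

lemma forms_single:
  "Poly_Mapping.keys \<alpha> \<subseteq> {..n} \<Longrightarrow> Poly_Mapping.single \<alpha> c \<in> forms n (monom_degree \<alpha>)"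
  by (simp add: forms_iff)

lemma forms_mvar: "i \<le> n \<Longrightarrow> mvar i \<in> forms n 1"
  using forms_single[of "Poly_Mapping.single i 1" n 1] by (simp add: mvar_def)

lemma forms_sum: "(\<And>a. a \<in> A \<Longrightarrow> g a \<in> forms n t) \<Longrightarrow> sum g A \<in> forms n t"
  by (induction A rule: infinite_finite_induct) (auto intro: forms_add)

lemma forms_one: "1 \<in> forms n 0"
  by (simp add: forms_iff)

lemma forms_power: "f \<in> forms n s \<Longrightarrow> f ^ k \<in> forms n (k * s)"
  by (induction k) (auto intro: forms_mult forms_one)

lemma forms_prod:
  "(\<And>a. a \<in> A \<Longrightarrow> g a \<in> forms n (d a)) \<Longrightarrow> prod g A \<in> forms n (sum d A)"
  by (induction A rule: infinite_finite_induct) (auto intro: forms_mult forms_one)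

lemma forms_subst:
  assumes f: "f \<in> forms n t" and \<tau>: "\<And>i. i \<le> n \<Longrightarrow> \<tau> i \<in> forms n 1"
  shows "subst (Poly_Mapping.single 0) \<tau> f \<in> forms n t"
  unfolding subst_def
proof (intro forms_sum forms_smult)
  fix \<alpha> assume \<alpha>: "\<alpha> \<in> Poly_Mapping.keys f"
  then have *: "Poly_Mapping.keys \<alpha> \<subseteq> {..n}" "monom_degree \<alpha> = t"
    using f by (auto simp: forms_iff)
  have "monom_eval \<tau> \<alpha> \<in> forms n (\<Sum>i\<in>Poly_Mapping.keys \<alpha>. Poly_Mapping.lookup \<alpha> i * 1)"
    unfolding monom_eval_def using * by (intro forms_prod forms_power \<tau>) auto
  then show "monom_eval \<tau> \<alpha> \<in> forms n t"
    using *(2) by (simp add: monom_degree_def)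
qed

declare One_nat_def [simp del]

section \<open>Order of vanishing at a point\<close>

text \<open>The degree of a monomial after dehomogenising by X_c = 1, that is, its order at the
  coordinate point of X_c.\<close>

definition off_degree :: "nat \<Rightarrow> (nat \<Rightarrow>\<^sub>0 nat) \<Rightarrow> nat" where
  "off_degree c \<alpha> = (\<Sum>i\<in>Poly_Mapping.keys \<alpha> - {c}. Poly_Mapping.lookup \<alpha> i)"

lemma off_degree_lookup: "off_degree c \<alpha> + Poly_Mapping.lookup \<alpha> c = monom_degree \<alpha>"
  by (cases "c \<in> Poly_Mapping.keys \<alpha>")
     (auto simp: off_degree_def monom_degree_def sum.remove[of _ c] in_keys_iff)

lemma off_degree_add: "off_degree c (\<alpha> + \<beta>) = off_degree c \<alpha> + off_degree c \<beta>"
  using off_degree_lookup[of c "\<alpha> + \<beta>"] off_degree_lookup[of c \<alpha>] off_degree_lookup[of c \<beta>]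
  by (simp add: monom_degree_add lookup_add)

text \<open>The m-th power of the ideal generated by the variables other than X_c, described by its
  monomials.\<close>

definition ord_ge :: "nat \<Rightarrow> nat \<Rightarrow> 'a::comm_ring_1 mpoly set" where
  "ord_ge c m = {p. \<forall>\<gamma>\<in>Poly_Mapping.keys p. m \<le> off_degree c \<gamma>}"

text \<open>Both the polynomials vanishing to order at least \<open>m\<close> at a point and the multiples of
  \<open>(X - a)\<^sup>m\<close> in \<open>K[X]\<close> are filtrations of this kind.\<close>

definition ring_filtration :: "(nat \<Rightarrow> 'b::comm_ring_1 set) \<Rightarrow> bool" where
  "ring_filtration D \<longleftrightarrow> D 0 = UNIV \<and> (\<forall>m. 0 \<in> D m) \<and> (\<forall>m. \<forall>x\<in>D m. \<forall>y\<in>D m. x + y \<in> D m) \<and>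
     (\<forall>k l. \<forall>x\<in>D k. \<forall>y\<in>D l. x * y \<in> D (k + l))"

lemma ring_filtrationD:
  assumes "ring_filtration D"
  shows "x \<in> D 0" "0 \<in> D m" "x \<in> D m \<Longrightarrow> y \<in> D m \<Longrightarrow> x + y \<in> D m"
    "x \<in> D k \<Longrightarrow> y \<in> D l \<Longrightarrow> x * y \<in> D (k + l)"
    "x \<in> D m \<Longrightarrow> y * x \<in> D m" "x \<in> D m \<Longrightarrow> x * y \<in> D m" "x \<in> D m \<Longrightarrow> - x \<in> D m"
proof -
  show "x \<in> D 0" "0 \<in> D m" "x \<in> D m \<Longrightarrow> y \<in> D m \<Longrightarrow> x + y \<in> D m"
    and *: "\<And>x y k l. x \<in> D k \<Longrightarrow> y \<in> D l \<Longrightarrow> x * y \<in> D (k + l)"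
    using assms by (auto simp: ring_filtration_def)
  \<comment> \<open>Multiplying by elements of \<open>D 0\<close>, which is the whole ring, makes
    every \<open>D m\<close> an ideal; negation is multiplication by \<open>- 1\<close>.\<close>
  have U: "z \<in> D 0" for z using assms by (auto simp: ring_filtration_def)
  show 1: "x \<in> D m \<Longrightarrow> y * x \<in> D m" for x y using *[OF U, of x m y] by simp
  show "x \<in> D m \<Longrightarrow> x * y \<in> D m" using *[OF _ U, of x m y] by simp
  show "x \<in> D m \<Longrightarrow> - x \<in> D m" using 1[of x "- 1"] by simp
qed

lemma ring_filtration_power:
  assumes "ring_filtration D" "x \<in> D k"
  shows "x ^ l \<in> D (l * k)"
  by (induction l) (auto intro: ring_filtrationD[OF assms(1)] assms)

lemma ring_filtration_ord_ge: "ring_filtration (ord_ge c)"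
  unfolding ring_filtration_def
proof (intro conjI allI ballI)
  fix m and x y :: "'a mpoly" assume "x \<in> ord_ge c m" "y \<in> ord_ge c m"
  then show "x + y \<in> ord_ge c m"
    using Poly_Mapping.keys_add[of x y] by (auto simp: ord_ge_def)
next
  fix k l and x y :: "'a mpoly" assume "x \<in> ord_ge c k" "y \<in> ord_ge c l"
  then show "x * y \<in> ord_ge c (k + l)"
    using Poly_Mapping.keys_mult[of x y] by (fastforce simp: ord_ge_def off_degree_add)
qed (auto simp: ord_ge_def)

lemma ring_filtration_dvd: "ring_filtration (\<lambda>m. {p. (q::'b::comm_ring_1) ^ m dvd p})"
  by (auto simp: ring_filtration_def power_add intro: mult_dvd_mono)

text \<open>A preimage of the ideal \<open>D m\<close>. Being an ideal, it contains everything
  generated by its elements, which is how a condition on generators spreads to \<wp>.\<close>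

lemma ideal_of_filtration:
  assumes D: "ring_filtration D" and H: "comm_ring_hom H"
  shows "ideal {f \<in> carrier (mpoly_ring n). H f \<in> D m} (mpoly_ring n :: 'a::comm_ring_1 mpoly ring)"
    (is "ideal ?I ?R")
proof -
  interpret H: comm_ring_hom H by fact
  interpret R: cring ?R by (rule cring_mpoly_ring)
  note D' = ring_filtrationD[OF D]
  have inv: "inv\<^bsub>add_monoid ?R\<^esub> x = - x" if "x \<in> carrier ?R" for x
  proof -
    have "\<ominus>\<^bsub>?R\<^esub> x = - x"
      using that by (intro R.minus_equality) (auto simp: mem_carrier_mpoly_ring)
    then show ?thesis by (simp add: a_inv_def)
  qed
  show ?thesis
  proof (rule idealI)
    show "subgroup ?I (add_monoid ?R)"
    proof
      fix x assume x: "x \<in> ?I"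
      then have "inv\<^bsub>add_monoid ?R\<^esub> x = - x" by (intro inv) auto
      moreover have "- x \<in> ?I"
        using x by (auto simp: H.hom_uminus mem_carrier_mpoly_ring intro: D')
      ultimately show "inv\<^bsub>add_monoid ?R\<^esub> x \<in> ?I" by (simp only:)
    qed (auto simp: carrier_add H.hom_add intro: D', auto simp: mem_carrier_mpoly_ring)
  qed (auto simp: carrier_mult H.hom_mult intro: D' R.ring_axioms)
qed

section \<open>Powers of the ideal of a point\<close>

lemma ideal_point_ideal: "ideal (point_ideal n Q) (mpoly_ring n)"
  unfolding point_ideal_def
  by (intro ring.genideal_ideal cring.axioms(1) cring_mpoly_ring) (auto simp: forms_in_carrier)

lemma ideal_pow:
  assumes "ideal I (mpoly_ring n :: 'a::comm_ring_1 mpoly ring)"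
  shows "ideal (I [^]\<^bsub>ideals_set (mpoly_ring n)\<^esub> (m::nat)) (mpoly_ring n)"
proof -
  interpret S: Group.comm_monoid "ideals_set (mpoly_ring n :: 'a mpoly ring)"
    by (rule cring.ideals_set_is_comm_monoid[OF cring_mpoly_ring])
  have "I [^]\<^bsub>ideals_set (mpoly_ring n)\<^esub> m \<in> carrier (ideals_set (mpoly_ring n))"
    using assms by (intro S.nat_pow_closed) (simp add: ideals_set_def)
  then show ?thesis by (simp add: ideals_set_def)
qed

lemma ideal_pow_0: "I [^]\<^bsub>ideals_set R\<^esub> (0::nat) = carrier R"
  by (simp add: ideals_set_def)

lemma ideal_pow_Suc: "I [^]\<^bsub>ideals_set R\<^esub> Suc m = (I [^]\<^bsub>ideals_set R\<^esub> m) \<cdot>\<^bsub>R\<^esub> I"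
  by (simp add: ideals_set_def)

text \<open>Only the generators, forms vanishing on \<open>Q\<close>, need checking:
  multiplicativity of the filtration carries degree 1 to degree \<open>m\<close> through products
  and sums. Applied once to \<open>shift\<close> with orders at a point, and once to restriction to
  the curve with multiplicities of roots.\<close>

lemma point_ideal_pow_filtration:
  assumes D: "ring_filtration D" and H: "comm_ring_hom H"
    and gen: "\<And>f d. f \<in> forms n d \<Longrightarrow> (\<And>v. v \<in> Q \<Longrightarrow> mpoly_eval f v = 0) \<Longrightarrow> H f \<in> D 1"
    and f: "f \<in> point_ideal n Q [^]\<^bsub>ideals_set (mpoly_ring n)\<^esub> m"
  shows "H f \<in> D m"
proof -
  interpret H: comm_ring_hom H by fact
  note D' = ring_filtrationD[OF D]
  have "point_ideal n Q \<subseteq> {f \<in> carrier (mpoly_ring n). H f \<in> D 1}"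
    unfolding point_ideal_def
    by (intro ring.genideal_minimal cring.axioms(1) cring_mpoly_ring ideal_of_filtration[OF D H])
       (auto simp: forms_in_carrier gen)
  then have 1: "H g \<in> D 1" if "g \<in> point_ideal n Q" for g using that by auto
  show ?thesis using f
  proof (induction m arbitrary: f)
    case 0 then show ?case by (auto intro: D')
  next
    case (Suc m)
    from Suc.prems have "f \<in> (point_ideal n Q [^]\<^bsub>ideals_set (mpoly_ring n)\<^esub> m)
        \<cdot>\<^bsub>mpoly_ring n\<^esub> point_ideal n Q"
      by (simp only: ideal_pow_Suc)
    then show ?case
    proof (induction rule: ideal_prod.induct)
      case (prod i j)
      then show ?case using D'(4)[OF Suc.IH 1, of i j] by (simp add: H.hom_mult Suc_eq_plus1)
    next
      case (sum x y) then show ?case by (auto simp: H.hom_add intro: D')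
    qed
  qed
qed

lemma ideal_mpoly_ringD:
  assumes "ideal I (mpoly_ring n)"
  shows "0 \<in> I" "x \<in> I \<Longrightarrow> y \<in> I \<Longrightarrow> x + y \<in> I"
    "r \<in> carrier (mpoly_ring n) \<Longrightarrow> x \<in> I \<Longrightarrow> r * x \<in> I" "I \<subseteq> carrier (mpoly_ring n)"
proof -
  interpret ideal I "mpoly_ring n" by fact
  show "0 \<in> I" using additive_subgroup.zero_closed[OF ideal.axioms(1)[OF assms]] by simp
  show "x \<in> I \<Longrightarrow> y \<in> I \<Longrightarrow> x + y \<in> I" using additive_subgroup.a_closed[OF ideal.axioms(1)[OF assms], of x y] by simp
  show "r \<in> carrier (mpoly_ring n) \<Longrightarrow> x \<in> I \<Longrightarrow> r * x \<in> I" using I_l_closed[of x r] by simp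
  show "I \<subseteq> carrier (mpoly_ring n)" by (rule a_subset)
qed

lemma ideal_mpoly_ring_sum:
  assumes "ideal I (mpoly_ring n)" "\<And>a. a \<in> A \<Longrightarrow> g a \<in> I"
  shows "sum g A \<in> I"
  using assms(2)
  by (induction A rule: infinite_finite_induct) (auto intro: ideal_mpoly_ringD[OF assms(1)])

lemma ideal_pow_mult:
  assumes "ideal I (mpoly_ring n :: 'a::comm_ring_1 mpoly ring)"
    and "x \<in> I [^]\<^bsub>ideals_set (mpoly_ring n)\<^esub> (k::nat)" "y \<in> I [^]\<^bsub>ideals_set (mpoly_ring n)\<^esub> (l::nat)"
  shows "x * y \<in> I [^]\<^bsub>ideals_set (mpoly_ring n)\<^esub> (k + l)"
proof -
  interpret S: Group.comm_monoid "ideals_set (mpoly_ring n :: 'a mpoly ring)"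
    by (rule cring.ideals_set_is_comm_monoid[OF cring_mpoly_ring])
  have "(I [^]\<^bsub>ideals_set (mpoly_ring n)\<^esub> k) \<otimes>\<^bsub>ideals_set (mpoly_ring n)\<^esub>
      (I [^]\<^bsub>ideals_set (mpoly_ring n)\<^esub> l) = I [^]\<^bsub>ideals_set (mpoly_ring n)\<^esub> (k + l)"
    using assms by (intro S.nat_pow_mult) (simp add: ideals_set_def)
  then have "I [^]\<^bsub>ideals_set (mpoly_ring n)\<^esub> (k + l) = (I [^]\<^bsub>ideals_set (mpoly_ring n)\<^esub> k)
      \<cdot>\<^bsub>mpoly_ring n\<^esub> (I [^]\<^bsub>ideals_set (mpoly_ring n)\<^esub> l)"
    by (simp add: ideals_set_def)
  moreover have "x \<otimes>\<^bsub>mpoly_ring n\<^esub> y \<in> (I [^]\<^bsub>ideals_set (mpoly_ring n)\<^esub> k)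
      \<cdot>\<^bsub>mpoly_ring n\<^esub> (I [^]\<^bsub>ideals_set (mpoly_ring n)\<^esub> l)"
    using assms(2,3) by (rule ideal_prod.prod)
  ultimately show ?thesis by simp
qed

lemma ideal_pow_1:
  assumes "ideal I (mpoly_ring n :: 'a::comm_ring_1 mpoly ring)" "x \<in> I"
  shows "x \<in> I [^]\<^bsub>ideals_set (mpoly_ring n)\<^esub> (1::nat)"
proof -
  have "1 \<otimes>\<^bsub>mpoly_ring n\<^esub> x \<in> carrier (mpoly_ring n) \<cdot>\<^bsub>mpoly_ring n\<^esub> I"
    using assms(2) by (intro ideal_prod.prod) (auto simp: mem_carrier_mpoly_ring)
  then show ?thesis using ideal_pow_Suc[of "mpoly_ring n" I 0] by (simp add: ideal_pow_0 One_nat_def del: nat_pow_0 nat_pow_Suc)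
qed

lemma ideal_pow_mono:
  assumes I: "ideal I (mpoly_ring n :: 'a::comm_ring_1 mpoly ring)" and "k \<le> l"
  shows "I [^]\<^bsub>ideals_set (mpoly_ring n)\<^esub> l \<subseteq> I [^]\<^bsub>ideals_set (mpoly_ring n)\<^esub> (k::nat)"
  using \<open>k \<le> l\<close>
proof (induction rule: dec_induct)
  case (step l)
  have "I [^]\<^bsub>ideals_set (mpoly_ring n)\<^esub> Suc l \<subseteq> I [^]\<^bsub>ideals_set (mpoly_ring n)\<^esub> l"
    using ring.ideal_prod_inter[OF cring.axioms(1)[OF cring_mpoly_ring] ideal_pow[OF I, of l] I]
    unfolding ideal_pow_Suc by blast
  with step show ?case by blast
qed simp

text \<open>Every variable other than the one at \<open>c\<close> contributes its exponent to the
  power of \<open>I\<close>.\<close>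

lemma monom_eval_in_ideal_pow:
  assumes I: "ideal I (mpoly_ring n :: 'a::comm_ring_1 mpoly ring)"
    and "\<And>i. i \<in> Poly_Mapping.keys \<gamma> - {c} \<Longrightarrow> x i \<in> I" 
    and "\<And>i. i \<in> Poly_Mapping.keys \<gamma> \<Longrightarrow> x i \<in> carrier (mpoly_ring n)"
  shows "monom_eval x \<gamma> \<in> I [^]\<^bsub>ideals_set (mpoly_ring n)\<^esub> off_degree c \<gamma>"
proof -
  let ?P = "\<lambda>k::nat. I [^]\<^bsub>ideals_set (mpoly_ring n)\<^esub> k"
  have one: "1 \<in> ?P 0" unfolding ideal_pow_0 by (simp add: mem_carrier_mpoly_ring)
  have pw: "x i ^ k \<in> ?P (k * d)" if "x i \<in> ?P d" for i k d
  proof (induction k)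
    case (Suc k)
    show ?case using ideal_pow_mult[OF I that Suc] by (simp add: mult.commute)
  qed (use one in simp)
  \<comment> \<open>Used with \<open>d\<close> equal to 1 for the variables off \<open>c\<close>,
    and to 0 for \<open>c\<close> itself, since the zeroth power is the whole ring.\<close>
  have pr: "(\<Prod>i\<in>S. x i ^ Poly_Mapping.lookup \<gamma> i) \<in> ?P (\<Sum>i\<in>S. Poly_Mapping.lookup \<gamma> i * d)"
    if "\<And>i. i \<in> S \<Longrightarrow> x i \<in> ?P d" for S d
    using that
    by (induction S rule: infinite_finite_induct)
       (use one in \<open>auto intro: ideal_pow_mult[OF I] pw\<close>)
  have "monom_eval x \<gamma> = (\<Prod>i\<in>Poly_Mapping.keys \<gamma> - {c}. x i ^ Poly_Mapping.lookup \<gamma> i) *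
      (\<Prod>i\<in>Poly_Mapping.keys \<gamma> \<inter> {c}. x i ^ Poly_Mapping.lookup \<gamma> i)"
    unfolding monom_eval_def by (subst prod.Int_Diff[of _ _ "{c}"]) (simp_all add: mult.commute)
  moreover have "(\<Prod>i\<in>Poly_Mapping.keys \<gamma> - {c}. x i ^ Poly_Mapping.lookup \<gamma> i) \<in>
      ?P (\<Sum>i\<in>Poly_Mapping.keys \<gamma> - {c}. Poly_Mapping.lookup \<gamma> i * 1)"
    using assms by (intro pr ideal_pow_1[OF I]) auto
  moreover have "(\<Prod>i\<in>Poly_Mapping.keys \<gamma> \<inter> {c}. x i ^ Poly_Mapping.lookup \<gamma> i) \<in>
      ?P (\<Sum>i\<in>Poly_Mapping.keys \<gamma> \<inter> {c}. Poly_Mapping.lookup \<gamma> i * 0)"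
    using assms(3) by (intro pr) (simp only: ideal_pow_0, blast)
  ultimately show ?thesis
    using ideal_pow_mult[OF I] unfolding off_degree_def by fastforce
qed

section \<open>Local coordinates at a point\<close>

text \<open>Fixes an affine chart X_c = 1 containing the point, with the entries of \<open>v\<close>
  as its affine coordinates.\<close>

definition normalized_at :: "nat \<Rightarrow> 'a::field vec set \<Rightarrow> nat \<Rightarrow> 'a vec \<Rightarrow> bool" where
  "normalized_at n Q c v \<longleftrightarrow> c \<le> n \<and> v \<in> carrier_vec (n + 1) \<and> v $ c = 1 \<and>
     Q = {k \<cdot>\<^sub>v v | k. k \<noteq> 0}"

lemma normalized_at_exists:
  assumes "Q \<in> proj_space n"
  obtains c v where "normalized_at n Q c v"
proof -
  let ?S = "carrier_vec (n + 1) - {0\<^sub>v (n + 1) :: 'a vec}"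
  from assms obtain w where w: "w \<in> ?S" "Q = proportional n `` {w}"
    unfolding proj_space_def by (auto elim: quotientE)
  have "\<exists>c<n + 1. w $ c \<noteq> 0"
  proof (rule ccontr)
    assume "\<not> ?thesis"
    then have "w = 0\<^sub>v (n + 1)" using w by (intro eq_vecI) auto
    with w show False by auto
  qed
  then obtain c where c: "c < n + 1" "w $ c \<noteq> 0" by blast
  define v where "v = (1 / w $ c) \<cdot>\<^sub>v w"
  have v: "v \<in> carrier_vec (n + 1)" "v $ c = 1"
    using w c by (auto simp: v_def)
  have wv: "w = (w $ c) \<cdot>\<^sub>v v" using w c by (auto simp: v_def smult_smult_assoc)
  have nz: "k \<cdot>\<^sub>v v \<noteq> 0\<^sub>v (n + 1)" if "k \<noteq> 0" for k
  proof
    assume "k \<cdot>\<^sub>v v = 0\<^sub>v (n + 1)"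
    then have "(k \<cdot>\<^sub>v v) $ c = 0" using c by simp
    then show False using v c that by simp
  qed
  have "Q = {k \<cdot>\<^sub>v v | k. k \<noteq> 0}"
  proof (intro equalityI subsetI)
    fix x assume "x \<in> Q"
    then obtain k where "k \<noteq> 0" "x = k \<cdot>\<^sub>v w" using w by (auto simp: proportional_def)
    then show "x \<in> {k \<cdot>\<^sub>v v | k. k \<noteq> 0}"
      using c wv by (intro CollectI exI[of _ "k * w $ c"]) (metis mult_eq_0_iff smult_smult_assoc)
  next
    fix x assume "x \<in> {k \<cdot>\<^sub>v v | k. k \<noteq> 0}"
    then obtain k where k: "k \<noteq> 0" "x = k \<cdot>\<^sub>v v" by blast
    have "x = (k / w $ c) \<cdot>\<^sub>v w" using k by (simp add: v_def smult_smult_assoc)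
    then show "x \<in> Q" using w k nz[OF k(1)] v c unfolding proportional_def
      by (auto intro!: exI[of _ "k / w $ c"])
  qed
  with v c show thesis by (intro that[of c v]) (auto simp: normalized_at_def)
qed

lemma normalized_atD:
  assumes "normalized_at n Q c v"
  shows "c \<le> n" "v \<in> carrier_vec (n + 1)" "dim_vec v = n + 1" "v $ c = 1" "Q = {k \<cdot>\<^sub>v v | k. k \<noteq> 0}"
proof -
  show "c \<le> n" "v \<in> carrier_vec (n + 1)" "v $ c = 1" "Q = {k \<cdot>\<^sub>v v | k. k \<noteq> 0}"
    using assms unfolding normalized_at_def by - (elim conjE, assumption)+
  then show "dim_vec v = n + 1" by (intro carrier_vecD)
qed

lemma normalized_atE:
  assumes "normalized_at n Q c v" "x \<in> Q"
  obtains k where "k \<noteq> 0" "x = k \<cdot>\<^sub>v v"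
proof -
  have "x \<in> {k \<cdot>\<^sub>v v | k. k \<noteq> 0}" using assms(2) normalized_atD(5)[OF assms(1)] by (simp only:)
  then show thesis by (elim CollectE exE conjE) (rule that)
qed

lemma normalized_at_smult_mem:
  assumes "normalized_at n Q c v" "k \<noteq> 0"
  shows "k \<cdot>\<^sub>v v \<in> Q"
  unfolding normalized_atD(5)[OF assms(1)] by (intro CollectI exI[of _ k] conjI refl assms(2))

lemma normalized_at_mem:
  assumes "normalized_at n Q c v"
  shows "v \<in> Q"
  using normalized_at_smult_mem[OF assms, of 1] by simp

lemma normalized_at_eqI:
  assumes Q: "normalized_at n Q c v" and Q': "normalized_at n Q' c' v'" and w: "w \<in> Q" "w \<in> Q'"
  shows "Q = Q'"
proof -
  have sub: "Q\<^sub>1 \<subseteq> Q\<^sub>2" if Q1: "normalized_at n Q\<^sub>1 c\<^sub>1 v\<^sub>1" and Q2: "normalized_at n Q\<^sub>2 c\<^sub>2 v\<^sub>2"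
    and w: "w \<in> Q\<^sub>1" "w \<in> Q\<^sub>2" for Q\<^sub>1 Q\<^sub>2 c\<^sub>1 c\<^sub>2 v\<^sub>1 v\<^sub>2
  proof
    fix x assume "x \<in> Q\<^sub>1"
    with Q1 obtain k where x: "k \<noteq> 0" "x = k \<cdot>\<^sub>v v\<^sub>1" by (rule normalized_atE)
    from Q1 w(1) obtain a where a: "a \<noteq> 0" "w = a \<cdot>\<^sub>v v\<^sub>1" by (rule normalized_atE)
    from Q2 w(2) obtain b where b: "b \<noteq> 0" "w = b \<cdot>\<^sub>v v\<^sub>2" by (rule normalized_atE)
    have "x = (k / a) \<cdot>\<^sub>v w" using a(1) by (simp add: x(2) a(2) smult_smult_assoc)
    also have "\<dots> = (k / a * b) \<cdot>\<^sub>v v\<^sub>2" by (simp add: b(2) smult_smult_assoc)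
    finally show "x \<in> Q\<^sub>2"
      using normalized_at_smult_mem[OF Q2, of "k / a * b"] x(1) a(1) b(1) by simp
  qed
  show ?thesis
    by (rule equalityI[OF sub[OF Q Q' w] sub[OF Q' Q w(2,1)]])
qed

text \<open>Homogeneous coordinates adapted to the point: if \<open>v $ c = 1\<close>, the forms
  with index other than \<open>c\<close> vanish at \<open>v\<close>, and X_c is kept as the
  dehomogenising variable.\<close>

definition chart :: "nat \<Rightarrow> 'a::comm_ring_1 vec \<Rightarrow> nat \<Rightarrow> 'a mpoly" where
  "chart c v i = (if i = c then mvar c else mvar i - Poly_Mapping.single 0 (v $ i) * mvar c)"

text \<open>Inverse to substituting \<open>chart c v\<close>: it expresses a polynomial in the
  adapted coordinates, where the point becomes the coordinate point of X_c and \<open>ord_ge\<close>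
  reads off the order of vanishing.\<close>

definition shift :: "nat \<Rightarrow> 'a::comm_ring_1 vec \<Rightarrow> 'a mpoly \<Rightarrow> 'a mpoly" where
  "shift c v = subst (Poly_Mapping.single 0)
     (\<lambda>i. if i = c then mvar c else mvar i + Poly_Mapping.single 0 (v $ i) * mvar c)"

lemma comm_ring_hom_shift: "comm_ring_hom (shift c v)"
  unfolding shift_def by (rule comm_ring_hom.comm_ring_hom_subst[OF comm_ring_hom_const])

text \<open>The terms \<open>h (v $ i) * \<phi> c\<close> cancel against those introduced by
  \<open>shift\<close>. With \<open>mvar\<close> for \<phi> this inverts \<open>shift\<close>; with
  the entries of \<open>v\<close> it evaluates at the point.\<close>

lemma subst_shift:
  assumes "comm_ring_hom h"
  shows "subst h \<phi> f = subst h (\<lambda>i. if i = c then \<phi> c else \<phi> i - h (v $ i) * \<phi> c) (shift c v f)"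
proof -
  interpret h: comm_ring_hom h by fact
  show ?thesis
    unfolding shift_def subst_subst[OF assms]
    by (rule arg_cong[of _ _ "\<lambda>\<tau>. subst h \<tau> f"])
       (auto simp: fun_eq_iff h.subst_add h.subst_mult)
qed

lemma subst_chart_shift: "subst (Poly_Mapping.single 0) (chart c v) (shift c v f) = f"
proof -
  have "chart c v = (\<lambda>i. if i = c then mvar c else mvar i - Poly_Mapping.single 0 (v $ i) * mvar c)"
    by (auto simp: chart_def)
  then show ?thesis
    using subst_shift[OF comm_ring_hom_const, of mvar f c v] by (simp add: subst_id)
qed

lemma shift_subst_chart: "shift c v (subst (Poly_Mapping.single 0) (chart c v) f) = f"
proof -
  interpret comm_ring_hom "Poly_Mapping.single 0 :: 'a \<Rightarrow> 'a mpoly" by (rule comm_ring_hom_const)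
  interpret s: comm_ring_hom "shift c v" by (rule comm_ring_hom_shift)
  have "shift c v (subst (Poly_Mapping.single 0) (chart c v) f)
      = subst (Poly_Mapping.single 0) (\<lambda>i. shift c v (chart c v i)) f"
    unfolding shift_def by (subst subst_subst[OF comm_ring_hom_const]) simp
  also have "(\<lambda>i. shift c v (chart c v i)) = mvar"
    by (auto simp: fun_eq_iff chart_def s.hom_minus s.hom_mult) 
       (auto simp: shift_def subst_const)
  finally show ?thesis by (simp add: subst_id)
qed

lemma chart_form: "c \<le> n \<Longrightarrow> i \<le> n \<Longrightarrow> chart c v i \<in> forms n 1"
  using forms_smult[OF forms_mvar, of c n "v $ i"]
  by (auto simp: chart_def intro: forms_diff forms_mvar)

lemma shift_form: "c \<le> n \<Longrightarrow> f \<in> forms n t \<Longrightarrow> shift c v f \<in> forms n t"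
  unfolding shift_def using forms_smult[OF forms_mvar, of c n]
  by (intro forms_subst) (auto intro: forms_add forms_mvar)

lemma monom_eq_single_iff:
  assumes "monom_degree \<gamma> = d"
  shows "off_degree c \<gamma> = 0 \<longleftrightarrow> \<gamma> = Poly_Mapping.single c d"
proof
  assume *: "off_degree c \<gamma> = 0"
  show "\<gamma> = Poly_Mapping.single c d"
  proof (rule poly_mapping_eqI)
    fix i
    show "Poly_Mapping.lookup \<gamma> i = Poly_Mapping.lookup (Poly_Mapping.single c d) i"
      using * off_degree_lookup[of c \<gamma>] assms
      by (cases "i = c") (auto simp: off_degree_def lookup_single in_keys_iff when_def)
  qed
qed (auto simp: off_degree_def)

text \<open>In adapted coordinates \<open>v\<close> is 1 at \<open>c\<close> and 0 elsewhere, so of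
  all monomials of degree \<open>d\<close> only X_c^d survives evaluation.\<close>

lemma lookup_shift_eq_eval:
  assumes c: "c \<le> n" and v: "v $ c = 1" and f: "f \<in> forms n d"
  shows "Poly_Mapping.lookup (shift c v f) (Poly_Mapping.single c d) = mpoly_eval f v"
proof -
  let ?\<phi> = "\<lambda>i. if i = c then 1 else (0::'a)"
  have "mpoly_eval f v = subst (\<lambda>x. x) (\<lambda>i. if i = c then v $ c else v $ i - v $ i * v $ c) (shift c v f)"
    unfolding mpoly_eval_eq_subst by (rule subst_shift[OF comm_ring_hom_ident])
  also have "\<dots> = subst (\<lambda>x. x) ?\<phi> (shift c v f)"
    by (rule arg_cong[of _ _ "\<lambda>\<tau>. subst _ \<tau> _"]) (auto simp: v)
  also have "\<dots> = (\<Sum>\<gamma>\<in>Poly_Mapping.keys (shift c v f). if \<gamma> = Poly_Mapping.single c d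
      then Poly_Mapping.lookup (shift c v f) \<gamma> else 0)"
    unfolding subst_def
  proof (intro sum.cong refl)
    fix \<gamma> assume "\<gamma> \<in> Poly_Mapping.keys (shift c v f)"
    then have deg: "monom_degree \<gamma> = d" using shift_form[OF c f] by (auto simp: forms_iff)
    show "Poly_Mapping.lookup (shift c v f) \<gamma> * monom_eval ?\<phi> \<gamma> =
      (if \<gamma> = Poly_Mapping.single c d then Poly_Mapping.lookup (shift c v f) \<gamma> else 0)"
    proof (cases "off_degree c \<gamma> = 0")
      case True
      then show ?thesis using monom_eq_single_iff[OF deg, of c] by simp
    next
      case False
      then obtain i where "i \<in> Poly_Mapping.keys \<gamma>" "i \<noteq> c"
        by (auto simp: off_degree_def)
      then have "monom_eval ?\<phi> \<gamma> = 0"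
        unfolding monom_eval_def by (intro prod_zero bexI[of _ i]) (auto simp: in_keys_iff power_0_left)
      with False show ?thesis using monom_eq_single_iff[OF deg, of c] by simp
    qed
  qed
  also have "\<dots> = Poly_Mapping.lookup (shift c v f) (Poly_Mapping.single c d)"
    by (auto simp: in_keys_iff)
  finally show ?thesis by simp
qed

text \<open>By the filtration lemma it suffices to treat a form vanishing at \<open>v\<close>: it
  has no X_c^d term in adapted coordinates, and every other monomial of degree \<open>d\<close> has
  order at least 1.\<close>

lemma shift_pow_ord_ge:
  assumes Q: "normalized_at n Q c v"
    and f: "f \<in> point_ideal n Q [^]\<^bsub>ideals_set (mpoly_ring n)\<^esub> m"
  shows "shift c v f \<in> ord_ge c m"
proof (rule point_ideal_pow_filtration[OF ring_filtration_ord_ge comm_ring_hom_shift _ f])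
  fix f d assume f: "f \<in> forms n d" and z: "\<And>v. v \<in> Q \<Longrightarrow> mpoly_eval f v = 0"
  have "1 \<cdot>\<^sub>v v \<in> Q" using Q by (auto simp: normalized_at_def intro!: exI[of _ 1])
  then have "Poly_Mapping.lookup (shift c v f) (Poly_Mapping.single c d) = 0"
    using lookup_shift_eq_eval[of c n v f d] z[of v] Q f by (auto simp: normalized_at_def)
  moreover have "monom_degree \<gamma> = d" if "\<gamma> \<in> Poly_Mapping.keys (shift c v f)" for \<gamma>
    using that shift_form[of c n f d v] Q f by (auto simp: normalized_at_def forms_iff)
  ultimately have "off_degree c \<gamma> \<noteq> 0" if "\<gamma> \<in> Poly_Mapping.keys (shift c v f)" for \<gamma>
    using that monom_eq_single_iff[of \<gamma> d c] by (auto simp: in_keys_iff)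
  then show "shift c v f \<in> ord_ge c 1" by (auto simp: ord_ge_def One_nat_def Suc_le_eq)
qed

lemma mpoly_eval_chart:
  assumes "i \<noteq> c"
  shows "mpoly_eval (chart c v i) w = w $ i - v $ i * w $ c"
proof -
  interpret s: comm_ring_hom "subst (\<lambda>x::'a. x) (($) w)"
    by (rule comm_ring_hom.comm_ring_hom_subst[OF comm_ring_hom_ident])
  show ?thesis
    using assms by (simp add: mpoly_eval_eq_subst chart_def s.hom_minus s.hom_mult
      comm_ring_hom.subst_mvar[OF comm_ring_hom_ident] comm_ring_hom.subst_const[OF comm_ring_hom_ident])
qed

lemma chart_in_point_ideal:
  assumes Q: "normalized_at n Q c v" and i: "i \<le> n" "i \<noteq> c"
  shows "chart c v i \<in> point_ideal n Q"
proof -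
  have *: "mpoly_eval (chart c v i) w = 0" if w: "w \<in> Q" for w
  proof -
    obtain k where "w = k \<cdot>\<^sub>v v" using normalized_atE[OF Q w] .
    then show ?thesis using i normalized_atD(1,3,4)[OF Q] by (simp add: mpoly_eval_chart)
  qed
  have "chart c v i \<in> forms n 1" using Q i by (intro chart_form) (auto simp: normalized_at_def)
  with * show ?thesis
    unfolding point_ideal_def
    by (intro subsetD[OF ring.genideal_self[OF cring.axioms(1)[OF cring_mpoly_ring]]])
       (auto simp: forms_in_carrier)
qed

text \<open>Written in the forms \<open>chart c v\<close>, each monomial of \<open>f\<close>
  contains at least \<open>m\<close> factors with index other than \<open>c\<close>, and these lie
  in \<wp>.\<close>

lemma ord_ge_imp_in_pow:
  assumes Q: "normalized_at n Q c v" and f: "f \<in> forms n t" and "shift c v f \<in> ord_ge c m"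
  shows "f \<in> point_ideal n Q [^]\<^bsub>ideals_set (mpoly_ring n)\<^esub> m" (is "_ \<in> ?P m")
proof -
  have c: "c \<le> n" using Q by (simp add: normalized_at_def)
  note I = ideal_point_ideal[of n Q]
  have "f = subst (Poly_Mapping.single 0) (chart c v) (shift c v f)"
    by (simp add: subst_chart_shift)
  also have "\<dots> \<in> ?P m"
    unfolding subst_def
  proof (intro ideal_mpoly_ring_sum[where n=n] ideal_pow I ideal_mpoly_ringD(3)[where n=n] const_in_carrier)
    fix \<gamma> assume \<gamma>: "\<gamma> \<in> Poly_Mapping.keys (shift c v f)"
    then have m: "m \<le> off_degree c \<gamma>" using assms by (auto simp: ord_ge_def)
    have k: "Poly_Mapping.keys \<gamma> \<subseteq> {..n}" using shift_form[OF c f] \<gamma> by (auto simp: forms_iff)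
    have "monom_eval (chart c v) \<gamma> \<in> ?P (off_degree c \<gamma>)"
      using k by (intro monom_eval_in_ideal_pow I chart_in_point_ideal[OF Q])
        (auto intro!: forms_in_carrier chart_form[OF c])
    then show "monom_eval (chart c v) \<gamma> \<in> ?P m"
      using ideal_pow_mono[OF I m] by blast
  qed
  finally show ?thesis .
qed

lemma form_in_pow_iff:
  assumes "normalized_at n Q c v" and "f \<in> forms n t"
  shows "f \<in> point_ideal n Q [^]\<^bsub>ideals_set (mpoly_ring n)\<^esub> m \<longleftrightarrow> shift c v f \<in> ord_ge c m"
  using assms shift_pow_ord_ge ord_ge_imp_in_pow by blast

section \<open>The Hilbert function as the rank of a linear map\<close>

definition fscale :: "'a::field \<Rightarrow> ('k \<Rightarrow> 'a) \<Rightarrow> 'k \<Rightarrow> 'a" where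
  "fscale c f = (\<lambda>x. c * f x)"

interpretation FV: vector_space "fscale :: 'a::field \<Rightarrow> ('k \<Rightarrow> 'a) \<Rightarrow> 'k \<Rightarrow> 'a"
  by standard (auto simp: fscale_def fun_eq_iff algebra_simps)

lemma mpoly_ring_minus:
  assumes "x \<in> carrier (mpoly_ring n)" "y \<in> carrier (mpoly_ring n)"
  shows "x \<ominus>\<^bsub>mpoly_ring n\<^esub> y = (x - y :: 'a::comm_ring_1 mpoly)"
proof -
  interpret R: cring "mpoly_ring n :: 'a mpoly ring" by (rule cring_mpoly_ring)
  have "\<ominus>\<^bsub>mpoly_ring n\<^esub> y = - y"
    using assms by (intro R.minus_equality) (auto simp: mem_carrier_mpoly_ring)
  then show ?thesis by (simp add: a_minus_def)
qed

lemma subfield_constants: "subfield constants (mpoly_ring n :: 'a::field mpoly ring)"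
proof -
  let ?R = "mpoly_ring n :: 'a mpoly ring"
  interpret R: cring ?R by (rule cring_mpoly_ring)
  have c: "constants \<subseteq> carrier ?R" by (auto simp: constants_def const_in_carrier)
  have "subring constants ?R"
  proof (rule R.subringI[OF c])
    fix h :: "'a mpoly" assume "h \<in> constants"
    then obtain k where k: "h = Poly_Mapping.single 0 k" by (auto simp: constants_def)
    have "\<ominus>\<^bsub>?R\<^esub> h = - h"
      using k by (intro R.minus_equality) (auto simp: mem_carrier_mpoly_ring)
    then show "\<ominus>\<^bsub>?R\<^esub> h \<in> constants" using k by (auto simp: constants_def simp flip: single_uminus)
  qed (auto simp: constants_def mult_single simp flip: single_add
       intro!: image_eqI[of 1 "Poly_Mapping.single 0" 1])
  then have sc: "subcring constants ?R" by (rule R.subcringI')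
  have "Units (?R\<lparr>carrier := constants\<rparr>) = constants - {\<zero>\<^bsub>?R\<^esub>}"
  proof (intro equalityI subsetI)
    fix x assume "x \<in> Units (?R\<lparr>carrier := constants\<rparr>)"
    then obtain y where "x \<in> constants" "x * y = 1" by (auto simp: Units_def)
    then show "x \<in> constants - {\<zero>\<^bsub>?R\<^esub>}" by auto
  next
    fix x assume "x \<in> constants - {\<zero>\<^bsub>?R\<^esub>}"
    then obtain k where "x = Poly_Mapping.single 0 k" "x \<noteq> 0" by (auto simp: constants_def)
    then have k: "x = Poly_Mapping.single 0 k" "k \<noteq> 0" by auto
    then have "x * Poly_Mapping.single 0 (1 / k) = 1" by (simp add: mult_single)
    then show "x \<in> Units (?R\<lparr>carrier := constants\<rparr>)"
      using k by (auto simp: Units_def constants_def mult.commute)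
  qed
  with sc show ?thesis by (rule R.subfieldI)
qed

lemma dim_quotient_eq_rank:
  fixes J :: "'a::field mpoly \<Rightarrow> 'k \<Rightarrow> 'a" and n :: nat
  defines "R \<equiv> mpoly_ring n :: 'a mpoly ring"
  assumes I: "ideal I R" and I1: "1 \<notin> I"
    and V: "V \<subseteq> carrier R" "0 \<in> V" "\<And>f g. f \<in> V \<Longrightarrow> g \<in> V \<Longrightarrow> f + g \<in> V"
      "\<And>f c. f \<in> V \<Longrightarrow> Poly_Mapping.single 0 c * f \<in> V"
    and J: "\<And>f g. f \<in> V \<Longrightarrow> g \<in> V \<Longrightarrow> J (f + g) = J f + J g"
      "\<And>f c. f \<in> V \<Longrightarrow> J (Poly_Mapping.single 0 c * f) = fscale c (J f)"
    and ker: "\<And>f. f \<in> V \<Longrightarrow> J f = 0 \<longleftrightarrow> f \<in> I"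
    and fin: "finite S" "J ` V \<subseteq> FV.span S"
  shows "ring.dim (R Quot I) ((+>\<^bsub>R\<^esub>) I ` constants) ((+>\<^bsub>R\<^esub>) I ` V) = FV.dim (J ` V)"
proof -
  let ?cls = "(+>\<^bsub>R\<^esub>) I"
  interpret R: cring R unfolding R_def by (rule cring_mpoly_ring)
  interpret I: ideal I R by (rule I)
  interpret h: ring_hom_ring R "R Quot I" ?cls by (rule I.rcos_ring_hom_ring)
  have Rs: "x \<otimes>\<^bsub>R\<^esub> y = x * y" "x \<oplus>\<^bsub>R\<^esub> y = x + y" "\<one>\<^bsub>R\<^esub> = 1" "\<zero>\<^bsub>R\<^esub> = 0" for x y
    by (auto simp: R_def)
  have cls_eq: "?cls f = ?cls g \<longleftrightarrow> f - g \<in> I" if "f \<in> carrier R" "g \<in> carrier R" for f g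
    using R.quotient_eq_iff_same_a_r_cos[OF I that] that
    by (simp add: R_def mpoly_ring_minus)
  have one_carr: "Poly_Mapping.single 0 c \<in> carrier R" for c
    by (simp add: R_def const_in_carrier)
  have cls_lin: "?cls (Poly_Mapping.single 0 c * f + g)
      = ?cls (Poly_Mapping.single 0 c) \<otimes>\<^bsub>R Quot I\<^esub> ?cls f \<oplus>\<^bsub>R Quot I\<^esub> ?cls g"
    if "f \<in> V" "g \<in> V" for c f g
  proof -
    have "Poly_Mapping.single 0 c * f \<in> carrier R" "f \<in> carrier R" "g \<in> carrier R"
      using V(1,4) that by blast+
    then show ?thesis
      using h.hom_add[of "Poly_Mapping.single 0 c * f" g] h.hom_mult[of "Poly_Mapping.single 0 c" f]
        one_carr[of c] by (simp only: Rs)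
  qed
  have V_diff: "f - Poly_Mapping.single 0 c * g \<in> V"
    and J_diff: "J (f - Poly_Mapping.single 0 c * g) = J f - fscale c (J g)"
    if "f \<in> V" "g \<in> V" for f g c
  proof -
    have *: "f - Poly_Mapping.single 0 c * g = f + Poly_Mapping.single 0 (- c) * g"
      by (simp add: single_uminus)
    show "f - Poly_Mapping.single 0 c * g \<in> V" unfolding * using that V by blast
    show "J (f - Poly_Mapping.single 0 c * g) = J f - fscale c (J g)"
      unfolding * J(1)[OF that(1) V(4)[OF that(2)]] J(2)[OF that(2)] by simp
  qed
  have J0: "J 0 = 0" using J(2)[OF V(2), of 0] by simp
  \<comment> \<open>Transports spans from functions to classes. Induction on the list matches
    \<open>Span\<close>, which adds one line at a time; the empty list is the kernel
    condition.\<close>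
  have span_map: "h.S.Span (?cls ` constants) (map ?cls fs)
      = ?cls ` {f \<in> V. J f \<in> FV.span (J ` set fs)}" if "set fs \<subseteq> V" for fs
    using that
  proof (induction fs)
    case Nil
    have "?cls f = \<zero>\<^bsub>R Quot I\<^esub>" if "f \<in> V" "J f = 0" for f
      using that ker[of f] V cls_eq[of f 0] V(1,2) h.hom_zero by (auto simp: Rs)
    then show ?case using V(2) J0 by (auto intro!: image_eqI[of _ _ 0] simp: Rs h.hom_zero[unfolded Rs])
  next
    case (Cons u us)
    then have u: "u \<in> V" and us: "set us \<subseteq> V" by auto
    have "h.S.Span (?cls ` constants) (map ?cls (u # us)) =
        {w. \<exists>k\<in>?cls ` constants. \<exists>z\<in>h.S.Span (?cls ` constants) (map ?cls us).
           w = k \<otimes>\<^bsub>R Quot I\<^esub> ?cls u \<oplus>\<^bsub>R Quot I\<^esub> z}"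
      by (rule Set.set_eqI) (simp add: h.S.line_extension_mem_iff)
    also have "\<dots> = ?cls ` {f \<in> V. J f \<in> FV.span (J ` set (u # us))}" (is "?A = ?B")
    proof (intro equalityI subsetI)
      fix w assume "w \<in> ?A"
      then obtain c g where g: "g \<in> V" "J g \<in> FV.span (J ` set us)"
        and w: "w = ?cls (Poly_Mapping.single 0 c) \<otimes>\<^bsub>R Quot I\<^esub> ?cls u \<oplus>\<^bsub>R Quot I\<^esub> ?cls g"
        unfolding Cons.IH[OF us] by (auto simp: constants_def)
      have "J (Poly_Mapping.single 0 c * u + g) = fscale c (J u) + J g"
        using J u g V(4) by simp
      moreover have "fscale c (J u) + J g \<in> FV.span (J ` set (u # us))"
      proof (rule FV.span_add)
        show "fscale c (J u) \<in> FV.span (J ` set (u # us))"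
          by (intro FV.span_scale FV.span_base) simp
        show "J g \<in> FV.span (J ` set (u # us))"
          using g(2) FV.span_mono[of "J ` set us" "J ` set (u # us)"] by auto
      qed
      ultimately show "w \<in> ?B"
        unfolding w cls_lin[OF u g(1), symmetric] using V(3,4) u g(1) by auto
    next
      fix w assume "w \<in> ?B"
      then obtain f where f: "f \<in> V" "w = ?cls f" "J f \<in> FV.span (insert (J u) (J ` set us))"
        by auto
      then obtain c where c: "J f - fscale c (J u) \<in> FV.span (J ` set us)"
        by (auto simp: FV.span_breakdown_eq)
      let ?g = "f - Poly_Mapping.single 0 c * u"
      have "?g \<in> V" "J ?g \<in> FV.span (J ` set us)"
        using V_diff[OF f(1) u] J_diff[OF f(1) u] c by auto
      moreover have "w = ?cls (Poly_Mapping.single 0 c) \<otimes>\<^bsub>R Quot I\<^esub> ?cls u \<oplus>\<^bsub>R Quot I\<^esub> ?cls ?g"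
        using cls_lin[OF u \<open>?g \<in> V\<close>, of c] f(2) by simp
      ultimately show "w \<in> ?A"
        unfolding Cons.IH[OF us] by (auto simp: constants_def)
    qed
    finally show ?case .
  qed
  have indep: "h.S.independent (?cls ` constants) (map ?cls fs)"
    if "set fs \<subseteq> V" "distinct (map J fs)" "FV.independent (J ` set fs)" for fs
    using that
  proof (induction fs)
    case (Cons u us)
    then have u: "u \<in> V" and us: "set us \<subseteq> V" by auto
    have nu: "J u \<notin> J ` set us" "FV.independent (J ` set us)" "J u \<notin> FV.span (J ` set us)"
      using Cons.prems by (auto simp: FV.independent_insert split: if_splits)
    have "?cls u \<notin> h.S.Span (?cls ` constants) (map ?cls us)"
    proof
      assume "?cls u \<in> h.S.Span (?cls ` constants) (map ?cls us)"
      then obtain g where g: "g \<in> V" "?cls u = ?cls g" "J g \<in> FV.span (J ` set us)"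
        unfolding span_map[OF us] by auto
      then have "u - g \<in> I" using cls_eq[of u g] u V(1) by auto
      moreover have "u - g \<in> V" "J (u - g) = J u - J g"
        using V_diff[OF u g(1), of 1] J_diff[OF u g(1), of 1] by (auto simp: fscale_def)
      ultimately have "J u = J g" using ker[of "u - g"] by simp
      with g nu show False by simp
    qed
    moreover have "?cls u \<in> carrier (R Quot I)" using u V(1) by auto
    ultimately show ?case
      using Cons nu us by (auto intro: h.S.independent.intros)
  qed auto
  \<comment> \<open>\<open>1 \<notin> I\<close> keeps the constants a field in the quotient.\<close>
  have K: "subfield (?cls ` constants) (R Quot I)"
  proof (rule h.img_is_subfield(2))
    show "subfield constants R" unfolding R_def by (rule subfield_constants)
    have "?cls 1 \<noteq> ?cls 0"
      using cls_eq[of 1 0] I1 by (auto simp: R_def mem_carrier_mpoly_ring)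
    then show "\<one>\<^bsub>R Quot I\<^esub> \<noteq> \<zero>\<^bsub>R Quot I\<^esub>"
      using h.hom_one h.hom_zero by (simp add: Rs)
  qed
  obtain B where B: "B \<subseteq> J ` V" "FV.independent B" "J ` V \<subseteq> FV.span B" "card B = FV.dim (J ` V)"
    by (rule FV.basis_exists)
  have "finite B"
    using FV.independent_span_bound[OF fin(1) B(2)] B(1) fin(2) by blast
  then obtain bs where bs: "set bs = B" "distinct bs" using finite_distinct_list by blast
  have "\<exists>pre. \<forall>b\<in>B. pre b \<in> V \<and> J (pre b) = b"
    using B(1) by (intro bchoice) auto
  then obtain pre where pre: "\<And>b. b \<in> B \<Longrightarrow> pre b \<in> V \<and> J (pre b) = b" by blast
  define fs where "fs = map pre bs"
  have Jfs: "map J fs = bs" unfolding fs_def using pre bs(1) by (auto intro: map_idI)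
  have fs: "set fs \<subseteq> V" "J ` set fs = B" "length fs = card B"
    using pre bs distinct_card[of bs] Jfs by (auto simp: fs_def) (metis Jfs fs_def image_eqI set_map)
  have "h.S.dimension (length (map ?cls fs)) (?cls ` constants) (h.S.Span (?cls ` constants) (map ?cls fs))"
    using fs bs Jfs B(2) by (intro h.S.dimension_independent indep) auto
  moreover have "{f \<in> V. J f \<in> FV.span (J ` set fs)} = V" using B(3) fs(2) by auto
  ultimately have "h.S.dimension (card B) (?cls ` constants) (?cls ` V)"
    using span_map[OF fs(1)] fs(3) by simp
  then show ?thesis using h.S.dimI[OF K] B(4) unfolding over_def by simp
qed

section \<open>Subspaces of functions with finite support\<close>

definition unit_fun :: "'k \<Rightarrow> 'k \<Rightarrow> 'a::field" where
  "unit_fun b = (\<lambda>x. if x = b then 1 else 0)"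

lemma fun_eq_sum_unit_fun:
  assumes "finite B" "\<And>x. x \<notin> B \<Longrightarrow> g x = 0"
  shows "g = (\<Sum>b\<in>B. fscale (g b) (unit_fun b))"
proof
  fix x
  have "(\<Sum>b\<in>B. fscale (g b) (unit_fun b)) x = (\<Sum>b\<in>B. if x = b then g b else 0)"
    by (induction B rule: infinite_finite_induct) (auto simp: fscale_def unit_fun_def)
  then show "g x = (\<Sum>b\<in>B. fscale (g b) (unit_fun b)) x" using assms by simp
qed

lemma supported_in_span:
  assumes "finite B" "\<And>x. x \<notin> B \<Longrightarrow> g x = 0"
  shows "g \<in> FV.span (unit_fun ` B)"
  by (subst fun_eq_sum_unit_fun[OF assms])
     (auto intro: FV.span_sum FV.span_scale FV.span_base)

text \<open>If \<open>W\<close> has full dimension but misses a unit function, adding that function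
  to a basis of \<open>W\<close> gives too many independent vectors in the span of the unit
  functions. This turns the numerical condition on the Hilbert function into solvability of
  interpolation problems.\<close>

lemma dim_eq_card_support_iff:
  fixes W :: "('k \<Rightarrow> 'a::field) set"
  assumes B: "finite B" and W: "FV.subspace W" and supp: "\<And>g x. g \<in> W \<Longrightarrow> x \<notin> B \<Longrightarrow> g x = 0"
  shows "FV.dim W = card B \<longleftrightarrow> (\<forall>b\<in>B. unit_fun b \<in> W)"
proof -
  let ?E = "unit_fun ` B :: ('k \<Rightarrow> 'a) set"
  have inj: "inj_on (unit_fun :: 'k \<Rightarrow> 'k \<Rightarrow> 'a) B"
  proof (rule inj_onI)
    fix x y :: 'k assume *: "(unit_fun x :: 'k \<Rightarrow> 'a) = unit_fun y"
    from fun_cong[OF this, of x] show "x = y" by (auto simp: unit_fun_def split: if_splits)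
  qed
  have WE: "W \<subseteq> FV.span ?E" using supported_in_span[OF B] supp by blast
  have indE: "FV.independent ?E"
  proof
    assume "FV.dependent ?E"
    then obtain u where u: "\<exists>v\<in>?E. u v \<noteq> 0" "(\<Sum>v\<in>?E. fscale (u v) v) = 0"
      using FV.dependent_finite[of ?E] B by auto
    from u(1) obtain b where b: "b \<in> B" "u (unit_fun b) \<noteq> 0" by auto
    have "(\<Sum>v\<in>?E. fscale (u v) v) = (\<Sum>b\<in>B. fscale (u (unit_fun b)) (unit_fun b))"
      by (subst sum.reindex[OF inj]) simp
    \<comment> \<open>The coefficients are extended by zero off \<open>B\<close>, so that their
      combination is again a function supported on \<open>B\<close>.\<close>
    also have "\<dots> = (\<Sum>c\<in>B. fscale ((\<lambda>c. if c \<in> B then u (unit_fun c) else 0) c) (unit_fun c))"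
      by (intro sum.cong) auto
    also have "\<dots> = (\<lambda>c. if c \<in> B then u (unit_fun c) else 0)"
      by (rule fun_eq_sum_unit_fun[symmetric]) (use B in auto)
    finally have "(\<lambda>c. if c \<in> B then u (unit_fun c) else 0) = 0" using u(2) by simp
    from fun_cong[OF this, of b] b show False by simp
  qed
  show ?thesis
  proof
    assume dim: "FV.dim W = card B"
    obtain C where C: "C \<subseteq> W" "FV.independent C" "W \<subseteq> FV.span C" "card C = FV.dim W"
      by (rule FV.basis_exists)
    have finE: "finite ?E" using B by simp
    have finC: "finite C" using FV.independent_span_bound[OF finE C(2)] C(1) WE by blast
    show "\<forall>b\<in>B. unit_fun b \<in> W"
    proof (rule ccontr)
      assume "\<not> ?thesis"
      then obtain b where b: "b \<in> B" "unit_fun b \<notin> W" by blast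
      then have nb: "unit_fun b \<notin> FV.span C" using FV.span_minimal[OF C(1) W] by blast
      have "insert (unit_fun b) C \<subseteq> FV.span ?E"
        using C(1) WE b(1) by (auto intro: FV.span_base)
      then have "card (insert (unit_fun b) C) \<le> card ?E"
        using FV.independent_span_bound[OF finE FV.independent_insertI[OF nb C(2)]] by blast
      moreover have "unit_fun b \<notin> C" using nb FV.span_base by blast
      ultimately show False using finC dim C(4) card_image[OF inj] by simp
    qed
  next
    assume "\<forall>b\<in>B. unit_fun b \<in> W"
    then have "?E \<subseteq> W" by auto
    then show "FV.dim W = card B"
      using FV.dim_unique[OF _ WE indE] card_image[OF inj] by simp
  qed
qed

section \<open>Counting monomials\<close>

text \<open>The monomials in the affine coordinates of the chart that can occur in a jet of order
  below \<open>m\<close>.\<close>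

definition local_exps :: "nat \<Rightarrow> nat \<Rightarrow> nat \<Rightarrow> (nat \<Rightarrow>\<^sub>0 nat) set" where
  "local_exps n c m = {\<beta>. Poly_Mapping.keys \<beta> \<subseteq> {..n} - {c} \<and> monom_degree \<beta> < m}"

lemma sum_list_length_Suc:
  "length l = Suc n \<Longrightarrow> sum_list l = (\<Sum>i\<le>n. l ! i)" for l :: "nat list"
  by (simp add: sum_list_sum_nth atLeast0LessThan lessThan_Suc_atMost)

text \<open>Stars and bars: the vacant slot \<open>c\<close> takes the slack
  \<open>m - 1 - monom_degree \<beta>\<close>, turning the bound on the degree into a fixed sum over
  n + 1 slots.\<close>

lemma bij_betw_local_exps:
  assumes c: "c \<le> n" and m: "m > 0"
  shows "bij_betw (\<lambda>\<beta>. map (\<lambda>i. if i = c then m - 1 - monom_degree \<beta> else Poly_Mapping.lookup \<beta> i) [0..<Suc n])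
     (local_exps n c m) {l. length l = Suc n \<and> sum_list l = m - 1}"
    (is "bij_betw ?F ?A ?B")
proof -
  let ?G = "\<lambda>l. \<Sum>i\<in>{..n}-{c}. Poly_Mapping.single i (l ! i) :: nat \<Rightarrow>\<^sub>0 nat"
  have lookG: "Poly_Mapping.lookup (?G l) i = (if i \<le> n \<and> i \<noteq> c then l ! i else 0)" for l i
    by (simp add: lookup_sum lookup_single when_def)
  have keysG: "Poly_Mapping.keys (?G l) \<subseteq> {..n} - {c}" for l
    using lookG by (auto simp: in_keys_iff split: if_splits)
  have degG: "monom_degree (?G l) = (\<Sum>i\<in>{..n}-{c}. l ! i)" for l
    by (subst monom_degree_superset[OF _ keysG]) (simp_all add: lookG)
  have sumB: "(\<Sum>i\<in>{..n}-{c}. l ! i) + l ! c = m - 1" if "l \<in> ?B" for l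
    using that c sum.remove[of "{..n}" c "(!) l"] sum_list_length_Suc[of l n] by simp
  have nthF: "?F \<beta> ! i = (if i = c then m - 1 - monom_degree \<beta> else Poly_Mapping.lookup \<beta> i)"
    if "i \<le> n" for \<beta> i
    using that by (simp del: upt_Suc)
  show ?thesis
  proof (rule bij_betw_byWitness[where f' = ?G])
    show "\<forall>\<beta>\<in>?A. ?G (?F \<beta>) = \<beta>"
    proof
      fix \<beta> assume \<beta>: "\<beta> \<in> ?A"
      show "?G (?F \<beta>) = \<beta>"
        by (rule poly_mapping_eqI, subst lookG)
           (use \<beta> in \<open>auto simp: nthF local_exps_def in_keys_iff simp del: upt_Suc\<close>)
    qed
    show "\<forall>l\<in>?B. ?F (?G l) = l"
    proof
      fix l assume l: "l \<in> ?B"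
      show "?F (?G l) = l"
      proof (rule nth_equalityI)
        fix i assume "i < length (?F (?G l))"
        then have "i \<le> n" by simp
        then show "?F (?G l) ! i = l ! i"
          using sumB[OF l] by (subst nthF) (auto simp: degG lookG)
      qed (use l in simp)
    qed
    show "?F ` ?A \<subseteq> ?B"
    proof safe
      fix \<beta> assume \<beta>: "\<beta> \<in> ?A"
      have "sum_list (?F \<beta>) = (\<Sum>i\<le>n. ?F \<beta> ! i)" by (rule sum_list_length_Suc) simp
      also have "\<dots> = (\<Sum>i\<le>n. if i = c then m - 1 - monom_degree \<beta> else Poly_Mapping.lookup \<beta> i)"
        by (intro sum.cong) (auto simp: nthF simp del: upt_Suc)
      also have "\<dots> = m - 1 - monom_degree \<beta> + (\<Sum>i\<in>{..n} - {c}. Poly_Mapping.lookup \<beta> i)"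
        using c by (simp add: sum.remove[of "{..n}" c])
      also have "(\<Sum>i\<in>{..n} - {c}. Poly_Mapping.lookup \<beta> i) = monom_degree \<beta>"
        using \<beta> by (intro monom_degree_superset[symmetric]) (auto simp: local_exps_def)
      finally show "sum_list (?F \<beta>) = m - 1" using \<beta> by (simp add: local_exps_def)
    qed simp
    show "?G ` ?B \<subseteq> ?A"
    proof safe
      fix l :: "nat list" assume "length l = Suc n" "sum_list l = m - 1"
      then have "l \<in> ?B" by simp
      from sumB[OF this] show "?G l \<in> ?A"
        using keysG m by (auto simp: local_exps_def degG)
    qed
  qed
qed

lemma card_local_exps:
  assumes c: "c \<le> n" and m: "m > 0"
  shows "card (local_exps n c m) = (m + n - 1) choose n"
proof -
  have "card (local_exps n c m) = card {l::nat list. length l = Suc n \<and> sum_list l = m - 1}"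
    by (rule bij_betw_same_card[OF bij_betw_local_exps[OF assms]])
  also have "\<dots> = (m - 1 + n) choose (m - 1)"
    by (subst card_length_sum_list) simp
  also have "\<dots> = (m - 1 + n) choose n"
    by (subst binomial_symmetric) auto
  finally show ?thesis using m by simp
qed

lemma finite_local_exps: "c \<le> n \<Longrightarrow> finite (local_exps n c m)"
proof (cases "m = 0")
  case False
  assume "c \<le> n"
  \<comment> \<open>An infinite set would have \<open>card\<close> 0, whereas the binomial
    coefficient is positive.\<close>
  then show ?thesis
    using card_local_exps[of c n m] False by (intro card_ge_0_finite) (simp add: zero_less_binomial)
qed (auto simp: local_exps_def)

section \<open>Jets at the fat points\<close>

lemma ord_ge_lookup: "p \<in> ord_ge c m \<Longrightarrow> off_degree c \<gamma> < m \<Longrightarrow> Poly_Mapping.lookup p \<gamma> = 0"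
  by (force simp: ord_ge_def in_keys_iff)

lemma off_degree_single_self [simp]: "off_degree c (Poly_Mapping.single c k) = 0"
  by (simp add: off_degree_def)

lemma off_degree_local: "Poly_Mapping.keys \<beta> \<subseteq> {..n} - {c} \<Longrightarrow> off_degree c \<beta> = monom_degree \<beta>"
  by (auto simp: off_degree_def monom_degree_def intro!: sum.cong)

lemma local_monomial_inj:
  assumes "Poly_Mapping.keys \<gamma> \<subseteq> {..n} - {c}" "Poly_Mapping.keys \<beta> \<subseteq> {..n} - {c}"
    and eq: "\<gamma> + Poly_Mapping.single c k = \<beta> + Poly_Mapping.single c l"
  shows "\<gamma> = \<beta>"
proof (rule poly_mapping_eqI)
  fix j
  show "Poly_Mapping.lookup \<gamma> j = Poly_Mapping.lookup \<beta> j"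
  proof (cases "j = c")
    case True
    then have "j \<notin> Poly_Mapping.keys \<gamma>" "j \<notin> Poly_Mapping.keys \<beta>" using assms by auto
    then show ?thesis by (simp add: in_keys_iff)
  next
    case False
    then show ?thesis
      using arg_cong[OF eq, of "\<lambda>p. Poly_Mapping.lookup p j"]
      by (simp add: lookup_add lookup_single)
  qed
qed

text \<open>A monomial of degree \<open>t\<close> is determined by its part off X_c. If
  \<open>monom_degree \<beta> > t\<close>, truncated subtraction gives X_c the exponent 0; the
  monomial then has degree above \<open>t\<close>, and its coefficient in a form of degree
  \<open>t\<close> is zero anyway.\<close>

lemma form_in_pow_iff_lookup:
  assumes Q: "normalized_at n Q c v" and f: "f \<in> forms n t"
  shows "f \<in> point_ideal n Q [^]\<^bsub>ideals_set (mpoly_ring n)\<^esub> m \<longleftrightarrow>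
    (\<forall>\<beta>\<in>local_exps n c m. Poly_Mapping.lookup (shift c v f)
       (\<beta> + Poly_Mapping.single c (t - monom_degree \<beta>)) = 0)"
  unfolding form_in_pow_iff[OF Q f]
proof (intro iffI ballI)
  fix \<beta> assume *: "shift c v f \<in> ord_ge c m" and \<beta>: "\<beta> \<in> local_exps n c m"
  show "Poly_Mapping.lookup (shift c v f) (\<beta> + Poly_Mapping.single c (t - monom_degree \<beta>)) = 0"
    using \<beta> by (intro ord_ge_lookup[OF *]) (auto simp: off_degree_add off_degree_local local_exps_def)
next
  assume *: "\<forall>\<beta>\<in>local_exps n c m. Poly_Mapping.lookup (shift c v f)
       (\<beta> + Poly_Mapping.single c (t - monom_degree \<beta>)) = 0"
  have c: "c \<le> n" using Q by (simp add: normalized_at_def)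
  show "shift c v f \<in> ord_ge c m"
    unfolding ord_ge_def
  proof (intro CollectI ballI, rule ccontr)
    fix \<gamma> assume \<gamma>: "\<gamma> \<in> Poly_Mapping.keys (shift c v f)" "\<not> m \<le> off_degree c \<gamma>"
    then have k: "Poly_Mapping.keys \<gamma> \<subseteq> {..n}" "monom_degree \<gamma> = t"
      using shift_form[OF c f] by (auto simp: forms_iff)
    define e where "e = Poly_Mapping.lookup \<gamma> c"
    define \<beta> where "\<beta> = \<gamma> - Poly_Mapping.single c e"
    have look: "Poly_Mapping.lookup \<beta> i = (if i = c then 0 else Poly_Mapping.lookup \<gamma> i)" for i
      by (simp add: \<beta>_def e_def lookup_minus lookup_single when_def)
    have keys: "Poly_Mapping.keys \<beta> \<subseteq> {..n} - {c}"
    proof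
      fix x assume "x \<in> Poly_Mapping.keys \<beta>"
      then have "x \<noteq> c" "x \<in> Poly_Mapping.keys \<gamma>" by (auto simp: in_keys_iff look split: if_splits)
      then show "x \<in> {..n} - {c}" using k(1) by blast
    qed
    have split: "\<gamma> = \<beta> + Poly_Mapping.single c e"
      by (rule poly_mapping_eqI) (simp add: e_def lookup_add look lookup_single when_def)
    have "off_degree c \<gamma> = monom_degree \<beta>"
      by (simp add: split off_degree_add off_degree_local[OF keys])
    then have "\<beta> \<in> local_exps n c m" using keys \<gamma> by (simp add: local_exps_def)
    moreover have "t - monom_degree \<beta> = e"
      using k(2) unfolding split monom_degree_add by simp
    ultimately have "Poly_Mapping.lookup (shift c v f) \<gamma> = 0" using * unfolding split by blast
    then show False using \<gamma>(1) by (simp add: in_keys_iff)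
  qed
qed

lemma comm_ring_hom_mpoly_eval: "comm_ring_hom (\<lambda>f. mpoly_eval f v)"
  unfolding mpoly_eval_eq_subst
  by (rule comm_ring_hom.comm_ring_hom_subst[OF comm_ring_hom_ident])

lemma shift_chart: "shift c v (chart c v i) = mvar i"
  using shift_subst_chart[of c v "mvar i"]
  by (simp add: comm_ring_hom.subst_mvar[OF comm_ring_hom_const])

lemma mvar_ord_ge: "i \<noteq> c \<Longrightarrow> mvar i \<in> ord_ge c 1"
  by (auto simp: mvar_def ord_ge_def off_degree_def)

text \<open>If all these forms vanished at \<open>v'\<close>, then \<open>v'\<close> would be
  \<open>v' $ c\<close> times \<open>v\<close>; the factor is nonzero because \<open>v'\<close> has
  an entry 1, so the points would coincide.\<close>

lemma separating_chart:
  assumes Q: "normalized_at n Q c v" and Q': "normalized_at n Q' c' v'" and ne: "Q \<noteq> Q'"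
  obtains l where "l \<le> n" "l \<noteq> c" "mpoly_eval (chart c v l) v' \<noteq> 0"
proof -
  note d = normalized_atD(3,4)[OF Q] normalized_atD(1,3,4)[OF Q']
  have "\<exists>l\<le>n. l \<noteq> c \<and> mpoly_eval (chart c v l) v' \<noteq> 0"
  proof (rule ccontr)
    assume *: "\<not> ?thesis"
    then have eq: "v' $ l = v $ l * v' $ c" if "l \<le> n" for l
      using that d by (cases "l = c") (auto simp: mpoly_eval_chart)
    have "v' = (v' $ c) \<cdot>\<^sub>v v"
      by (rule eq_vecI) (use d eq in \<open>auto simp: mult.commute\<close>)
    moreover have "v' $ c \<noteq> 0" using eq[of c'] d by auto
    ultimately have "v' \<in> Q" using normalized_at_smult_mem[OF Q, of "v' $ c"] by simp
    then show False using normalized_at_eqI[OF Q Q' _ normalized_at_mem[OF Q']] ne by simp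
  qed
  then obtain l where "l \<le> n" "l \<noteq> c" "mpoly_eval (chart c v l) v' \<noteq> 0" by blast
  then show thesis by (rule that)
qed

lemma shift_add: "shift c v (f + g) = shift c v f + shift c v g"
proof -
  interpret comm_ring_hom "shift c v" by (rule comm_ring_hom_shift)
  show ?thesis by (rule hom_add)
qed

lemma shift_one: "shift c v 1 = 1"
proof -
  interpret comm_ring_hom "shift c v" by (rule comm_ring_hom_shift)
  show ?thesis by (rule hom_one)
qed

lemma shift_smult: "shift c v (Poly_Mapping.single 0 a * f) = Poly_Mapping.map ((*) a) (shift c v f)"
proof -
  interpret comm_ring_hom "shift c v" by (rule comm_ring_hom_shift)
  show ?thesis
    unfolding mult_map_scale_conv_mult hom_mult
    by (simp add: shift_def comm_ring_hom.subst_const[OF comm_ring_hom_const])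
qed

text \<open>The charts \<open>c i\<close> and representatives \<open>v i\<close> are choices: the
  jets depend on them, the ideal of Z does not.\<close>

locale fat_points =
  fixes n s :: nat and P :: "nat \<Rightarrow> 'a::field vec set" and m c :: "nat \<Rightarrow> nat" and v :: "nat \<Rightarrow> 'a vec"
  assumes s_pos: "s \<ge> 1"
    and normalized: "\<And>i. i \<in> {1..s} \<Longrightarrow> normalized_at n (P i) (c i) (v i)"
    and inj_P: "inj_on P {1..s}"
    and m_pos: "\<And>i. i \<in> {1..s} \<Longrightarrow> m i > 0"
begin

lemma c_le: "i \<in> {1..s} \<Longrightarrow> c i \<le> n"
  using normalized normalized_atD(1) by blast

definition jet_index :: "(nat \<times> (nat \<Rightarrow>\<^sub>0 nat)) set" where
  "jet_index = Sigma {1..s} (\<lambda>i. local_exps n (c i) (m i))"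

text \<open>Coefficients of the dehomogenised form; the power of X_c only restores the degree
  \<open>t\<close>. The value 0 off \<open>jet_index\<close> places all jets in a space of dimension
  e(R/I).\<close>

definition jet :: "nat \<Rightarrow> 'a mpoly \<Rightarrow> nat \<times> (nat \<Rightarrow>\<^sub>0 nat) \<Rightarrow> 'a" where
  "jet t f = (\<lambda>(i, \<beta>). if (i, \<beta>) \<in> jet_index then Poly_Mapping.lookup (shift (c i) (v i) f)
     (\<beta> + Poly_Mapping.single (c i) (t - monom_degree \<beta>)) else 0)"

lemma finite_jet_index: "finite jet_index"
  using finite_local_exps c_le by (auto simp: jet_index_def)

lemma card_jet_index: "card jet_index = fat_multiplicity n s m"
  unfolding jet_index_def fat_multiplicity_def
  by (subst card_SigmaI) (auto simp: finite_local_exps c_le intro!: sum.cong card_local_exps m_pos)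

lemma jet_add: "jet t (f + g) = jet t f + jet t g"
  by (auto simp: jet_def fun_eq_iff lookup_add shift_add)

lemma jet_smult: "jet t (Poly_Mapping.single 0 a * f) = fscale a (jet t f)"
  by (auto simp: jet_def fun_eq_iff fscale_def shift_smult Poly_Mapping.map.rep_eq when_def)

lemma ideal_fat_ideal: "ideal (fat_ideal n s P m) (mpoly_ring n)"
proof -
  interpret R: cring "mpoly_ring n :: 'a mpoly ring" by (rule cring_mpoly_ring)
  show ?thesis
    unfolding fat_ideal_def using s_pos
    by (intro R.i_Intersect) (auto intro: ideal_pow ideal_point_ideal)
qed

lemma one_not_in_fat_ideal: "1 \<notin> fat_ideal n s P m"
proof
  assume "1 \<in> fat_ideal n s P m"
  then have "1 \<in> point_ideal n (P 1) [^]\<^bsub>ideals_set (mpoly_ring n)\<^esub> m 1"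
    using s_pos by (auto simp: fat_ideal_def)
  then have "shift (c 1) (v 1) 1 \<in> ord_ge (c 1) (m 1)"
    using s_pos by (intro shift_pow_ord_ge[OF normalized]) auto
  then have "(1 :: 'a mpoly) \<in> ord_ge (c 1) (m 1)"
    by (simp add: shift_one)
  then show False using m_pos[of 1] s_pos by (auto simp: ord_ge_def off_degree_def)
qed

lemma jet_eq_0_iff:
  assumes "f \<in> forms n t"
  shows "jet t f = 0 \<longleftrightarrow> f \<in> fat_ideal n s P m"
proof -
  have "f \<in> fat_ideal n s P m \<longleftrightarrow> (\<forall>i\<in>{1..s}. \<forall>\<beta>\<in>local_exps n (c i) (m i).
      Poly_Mapping.lookup (shift (c i) (v i) f)
       (\<beta> + Poly_Mapping.single (c i) (t - monom_degree \<beta>)) = 0)"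
    unfolding fat_ideal_def using form_in_pow_iff_lookup[OF normalized assms] by auto
  also have "\<dots> \<longleftrightarrow> jet t f = 0"
    by (auto simp: jet_def fun_eq_iff jet_index_def)
  finally show ?thesis by simp
qed

lemma subspace_jets: "FV.subspace (jet t ` forms n t)"
proof (rule FV.subspaceI)
  show "0 \<in> jet t ` forms n t"
    using jet_smult[of t 0 0] by (intro image_eqI[of _ _ 0]) (auto simp: fscale_def fun_eq_iff)
  fix x assume "x \<in> jet t ` forms n t"
  then obtain f where f: "f \<in> forms n t" "x = jet t f" by blast
  show "fscale a x \<in> jet t ` forms n t" for a
    using f forms_smult[OF f(1), of a] jet_smult[of t a f] by force
  fix y assume "y \<in> jet t ` forms n t"
  then obtain g where g: "g \<in> forms n t" "y = jet t g" by blast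
  show "x + y \<in> jet t ` forms n t"
    using f g forms_add[OF f(1) g(1)] jet_add[of t f g] by force
qed

lemma hilbert_fun_eq_iff:
  "hilbert_fun n (fat_ideal n s P m) t = fat_multiplicity n s m \<longleftrightarrow>
     (\<forall>b\<in>jet_index. unit_fun b \<in> jet t ` forms n t)"
proof -
  have supp: "g b = 0" if "g \<in> jet t ` forms n t" "b \<notin> jet_index" for g b
    using that by (auto simp: jet_def split: prod.splits)
  have "hilbert_fun n (fat_ideal n s P m) t = FV.dim (jet t ` forms n t)"
    unfolding hilbert_fun_def
  proof (rule dim_quotient_eq_rank)
    show "finite (unit_fun ` jet_index)" using finite_jet_index by simp
    show "jet t ` forms n t \<subseteq> FV.span (unit_fun ` jet_index)"
      using supported_in_span[OF finite_jet_index] supp by blast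
  qed (auto simp: ideal_fat_ideal one_not_in_fat_ideal forms_in_carrier jet_eq_0_iff jet_add jet_smult
         intro: forms_add forms_smult)
  moreover have "FV.dim (jet t ` forms n t) = card jet_index \<longleftrightarrow>
      (\<forall>b\<in>jet_index. unit_fun b \<in> jet t ` forms n t)"
    by (rule dim_eq_card_support_iff[OF finite_jet_index subspace_jets]) (rule supp)
  ultimately show ?thesis by (simp add: card_jet_index)
qed

text \<open>Products of powers of linear forms through the other points, times local monomials, have jets
  forming a triangular system.\<close>

lemma triangular_form:
  assumes i: "i \<in> {1..s}" and \<beta>: "\<beta> \<in> local_exps n (c i) (m i)"
  defines "t \<equiv> (\<Sum>k=1..s. m k)"
  obtains G where "G \<in> forms n t" "jet t G (i, \<beta>) \<noteq> 0"
    "\<And>k \<gamma>. (k, \<gamma>) \<in> jet_index \<Longrightarrow> (k, \<gamma>) \<noteq> (i, \<beta>) \<Longrightarrow> jet t G (k, \<gamma>) \<noteq> 0 \<Longrightarrow>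
       k = i \<and> monom_degree \<beta> < monom_degree \<gamma>"
proof -
  let ?K = "{1..s} - {i}"
  have "\<exists>l. \<forall>k\<in>?K. l k \<le> n \<and> l k \<noteq> c k \<and> mpoly_eval (chart (c k) (v k) (l k)) (v i) \<noteq> 0"
  proof (rule bchoice, rule ballI)
    fix k assume k: "k \<in> ?K"
    then have ks: "k \<in> {1..s}" and ne: "P k \<noteq> P i" using inj_onD[OF inj_P, of k i] i by auto
    obtain l where "l \<le> n" "l \<noteq> c k" "mpoly_eval (chart (c k) (v k) l) (v i) \<noteq> 0"
      by (rule separating_chart[OF normalized[OF ks] normalized[OF i] ne])
    then show "\<exists>l. l \<le> n \<and> l \<noteq> c k \<and> mpoly_eval (chart (c k) (v k) l) (v i) \<noteq> 0" by (intro exI conjI)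
  qed
  then obtain l where "\<forall>k\<in>?K. l k \<le> n \<and> l k \<noteq> c k \<and> mpoly_eval (chart (c k) (v k) (l k)) (v i) \<noteq> 0"
    by (rule exE)
  then have l: "\<And>k. k \<in> ?K \<Longrightarrow> l k \<le> n \<and> l k \<noteq> c k \<and> mpoly_eval (chart (c k) (v k) (l k)) (v i) \<noteq> 0"
    by blast
  \<comment> \<open>A linear form through \<open>P k\<close> but not through \<open>P i\<close>,
    raised to the power \<open>m k\<close>, kills the whole jet at \<open>P k\<close> and is
    invertible at \<open>P i\<close>.\<close>
  define g where "g = (\<Prod>k\<in>?K. chart (c k) (v k) (l k) ^ m k)"
  define d where "d = (\<Sum>k\<in>?K. m k)"
  \<comment> \<open>Pads the local monomial to degree \<open>m i\<close>, so that the degree of the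
    product is the same for all \<open>\<beta>\<close> and \<open>i\<close>.\<close>
  define e where "e = m i - monom_degree \<beta>"
  define \<beta>' where "\<beta>' = \<beta> + Poly_Mapping.single (c i) e"
  define h where "h = subst (Poly_Mapping.single 0) (chart (c i) (v i)) (Poly_Mapping.single \<beta>' 1)"
  have \<beta>_keys: "Poly_Mapping.keys \<beta> \<subseteq> {..n} - {c i}" "monom_degree \<beta> < m i"
    using \<beta> by (auto simp: local_exps_def)
  have ci: "c i \<le> n" and vi: "v i $ c i = 1" using normalized_atD[OF normalized[OF i]] by auto
  have t: "t = d + m i" unfolding t_def d_def using i by (simp add: sum.remove[of "{1..s}" i])
  have g_form: "g \<in> forms n d"
  proof -
    have "g \<in> forms n (\<Sum>k\<in>?K. m k * 1)"
      unfolding g_def using l c_le by (intro forms_prod forms_power chart_form) auto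
    then show ?thesis by (simp add: d_def)
  qed
  have "monom_degree \<beta>' = m i"
    using \<beta>_keys by (simp add: \<beta>'_def monom_degree_add e_def)
  moreover have "Poly_Mapping.keys \<beta>' \<subseteq> {..n}"
    using \<beta>_keys ci by (auto simp: \<beta>'_def keys_add_nat)
  ultimately have h_form: "h \<in> forms n (m i)"
    unfolding h_def using forms_single[of \<beta>' n "1::'a"] by (intro forms_subst chart_form ci) auto
  have shift_h: "shift (c i) (v i) h = Poly_Mapping.single \<beta>' 1"
    unfolding h_def by (rule shift_subst_chart)
  have G_form: "g * h \<in> forms n t" unfolding t by (rule forms_mult[OF g_form h_form])
  have other: "jet t (g * h) (k, \<gamma>) = 0" if "(k, \<gamma>) \<in> jet_index" "k \<noteq> i" for k \<gamma>
  proof -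
    interpret sh: comm_ring_hom "shift (c k) (v k)" by (rule comm_ring_hom_shift)
    have k: "k \<in> ?K" and \<gamma>: "\<gamma> \<in> local_exps n (c k) (m k)" using that by (auto simp: jet_index_def)
    \<comment> \<open>In the coordinates adapted to \<open>P k\<close> the chosen linear form is a
      variable other than X_c, hence of order 1.\<close>
    have "mvar (l k) ^ m k \<in> ord_ge (c k) (m k * 1)"
      using l[OF k] by (intro ring_filtration_power[OF ring_filtration_ord_ge] mvar_ord_ge) auto
    then have "shift (c k) (v k) (g * h) \<in> ord_ge (c k) (m k)"
      unfolding g_def using k
      by (subst prod.remove[of _ k])
         (auto simp: sh.hom_mult sh.hom_power shift_chart
           intro!: ring_filtrationD(6)[OF ring_filtration_ord_ge])
    then have "Poly_Mapping.lookup (shift (c k) (v k) (g * h))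
       (\<gamma> + Poly_Mapping.single (c k) (t - monom_degree \<gamma>)) = 0"
      using \<gamma> by (intro ord_ge_lookup) (auto simp: off_degree_add local_exps_def off_degree_local)
    then show ?thesis by (simp add: jet_def)
  qed
  interpret sh: comm_ring_hom "shift (c i) (v i)" by (rule comm_ring_hom_shift)
  interpret ev: comm_ring_hom "\<lambda>f. mpoly_eval f (v i)" by (rule comm_ring_hom_mpoly_eval)
  define a where "a = mpoly_eval g (v i)"
  have a: "a \<noteq> 0" unfolding a_def g_def using l by (simp add: ev.hom_prod ev.hom_power)
  \<comment> \<open>At \<open>P i\<close> the form \<open>g\<close> is its nonzero value
    \<open>a\<close> times a power of X_c, plus terms of positive order; these push \<beta> to
    strictly higher order only.\<close>
  define r where "r = shift (c i) (v i) g - Poly_Mapping.single (Poly_Mapping.single (c i) d) a"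
  have r: "r \<in> ord_ge (c i) 1"
  proof -
    have "off_degree (c i) \<gamma> \<noteq> 0" if "\<gamma> \<in> Poly_Mapping.keys r" for \<gamma>
    proof
      assume "off_degree (c i) \<gamma> = 0"
      moreover have "r \<in> forms n d"
        unfolding r_def using ci shift_form[OF ci g_form] forms_single[of "Poly_Mapping.single (c i) d" n a]
        by (intro forms_diff) auto
      ultimately have "\<gamma> = Poly_Mapping.single (c i) d"
        using monom_eq_single_iff[of \<gamma> d "c i"] that by (auto simp: forms_iff)
      then have "Poly_Mapping.lookup r \<gamma> = 0"
        using lookup_shift_eq_eval[of "c i" n "v i", OF ci vi g_form] by (simp add: r_def lookup_minus a_def)
      then show False using that by (simp add: in_keys_iff)
    qed
    then show ?thesis by (auto simp: ord_ge_def One_nat_def Suc_le_eq)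
  qed
  have "Poly_Mapping.single \<beta>' 1 \<in> ord_ge (c i) (monom_degree \<beta>)"
    using \<beta>_keys by (auto simp: ord_ge_def \<beta>'_def off_degree_add off_degree_local)
  then have rest: "r * Poly_Mapping.single \<beta>' 1 \<in> ord_ge (c i) (1 + monom_degree \<beta>)"
    by (rule ring_filtrationD(4)[OF ring_filtration_ord_ge r])
  have "shift (c i) (v i) (g * h) =
      Poly_Mapping.single (Poly_Mapping.single (c i) d + \<beta>') a + r * Poly_Mapping.single \<beta>' 1"
    by (simp add: sh.hom_mult shift_h r_def algebra_simps mult_single)
  also have "Poly_Mapping.single (c i) d + \<beta>' = \<beta> + Poly_Mapping.single (c i) (t - monom_degree \<beta>)"
    using \<beta>_keys by (simp add: \<beta>'_def e_def t add_ac flip: single_add)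
  finally have shift_G: "shift (c i) (v i) (g * h) =
      Poly_Mapping.single (\<beta> + Poly_Mapping.single (c i) (t - monom_degree \<beta>)) a
        + r * Poly_Mapping.single \<beta>' 1" .
  have same: "jet t (g * h) (i, \<gamma>) = (if \<gamma> = \<beta> then a else 0)"
    if "\<gamma> \<in> local_exps n (c i) (m i)" "monom_degree \<gamma> \<le> monom_degree \<beta>" for \<gamma>
  proof -
    let ?x = "\<lambda>\<gamma>. \<gamma> + Poly_Mapping.single (c i) (t - monom_degree \<gamma>)"
    have \<gamma>_keys: "Poly_Mapping.keys \<gamma> \<subseteq> {..n} - {c i}" using that by (simp add: local_exps_def)
    have "?x \<gamma> = ?x \<beta> \<longleftrightarrow> \<gamma> = \<beta>"
      using local_monomial_inj[OF \<gamma>_keys \<beta>_keys(1)] by auto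
    moreover have "Poly_Mapping.lookup (r * Poly_Mapping.single \<beta>' 1) (?x \<gamma>) = 0"
      using that \<gamma>_keys by (intro ord_ge_lookup[OF rest]) (simp add: off_degree_add off_degree_local)
    ultimately show ?thesis
      using that i by (auto simp: jet_def jet_index_def shift_G lookup_add lookup_single when_def)
  qed
  show thesis
  proof (rule that[OF G_form])
    show "jet t (g * h) (i, \<beta>) \<noteq> 0" using same[OF \<beta>] a by simp
    fix k \<gamma> assume *: "(k, \<gamma>) \<in> jet_index" "(k, \<gamma>) \<noteq> (i, \<beta>)" "jet t (g * h) (k, \<gamma>) \<noteq> 0"
    then have "k = i" using other by blast
    with * same[of \<gamma>] show "k = i \<and> monom_degree \<beta> < monom_degree \<gamma>"
      by (cases "monom_degree \<beta> < monom_degree \<gamma>") (auto simp: jet_index_def)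
  qed
qed

text \<open>Back substitution: the form belonging to \<beta> has, apart from its entry at \<beta>,
  only jet entries of higher degree at the same point. The unit jets there are already available,
  since the measure \<open>m i - monom_degree \<beta>\<close> drops as the degree rises.\<close>

lemma jets_surjective:
  defines "t \<equiv> (\<Sum>k=1..s. m k)"
  assumes "b \<in> jet_index"
  shows "unit_fun b \<in> jet t ` forms n t"
  using assms(2)
proof (induction b rule: measure_induct_rule[where f = "\<lambda>(i, \<beta>). m i - monom_degree \<beta>"])
  case (less b)
  let ?W = "jet t ` forms n t"
  note W = subspace_jets[of t]
  obtain i \<beta> where b: "b = (i, \<beta>)" by (cases b)
  have i: "i \<in> {1..s}" and \<beta>: "\<beta> \<in> local_exps n (c i) (m i)"
    using less.prems by (auto simp: b jet_index_def)
  from triangular_form[OF i \<beta>] obtain G where G: "G \<in> forms n t" "jet t G b \<noteq> 0"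
    and G': "\<And>k \<gamma>. (k, \<gamma>) \<in> jet_index \<Longrightarrow> (k, \<gamma>) \<noteq> b \<Longrightarrow> jet t G (k, \<gamma>) \<noteq> 0 \<Longrightarrow>
       k = i \<and> monom_degree \<beta> < monom_degree \<gamma>"
    unfolding t_def b by blast
  have term_in: "fscale (jet t G b') (unit_fun b') \<in> ?W" if b': "b' \<in> jet_index - {b}" for b'
  proof (cases "jet t G b' = 0")
    case True
    then show ?thesis using FV.subspace_0[OF W] by simp
  next
    case False
    obtain k \<gamma> where k: "b' = (k, \<gamma>)" by (cases b')
    with G' b' False have *: "k = i" "monom_degree \<beta> < monom_degree \<gamma>" by auto
    have "monom_degree \<gamma> < m i" using b' * k by (auto simp: jet_index_def local_exps_def)
    then have "unit_fun b' \<in> ?W" using * b' k b by (intro less.IH) auto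
    then show ?thesis by (rule FV.subspace_scale[OF W])
  qed
  have "jet t G = (\<Sum>b'\<in>jet_index. fscale (jet t G b') (unit_fun b'))"
    by (rule fun_eq_sum_unit_fun[OF finite_jet_index]) (auto simp: jet_def split: prod.splits)
  also have "\<dots> = fscale (jet t G b) (unit_fun b)
      + (\<Sum>b'\<in>jet_index - {b}. fscale (jet t G b') (unit_fun b'))"
    by (rule sum.remove[OF finite_jet_index less.prems])
  finally have "fscale (jet t G b) (unit_fun b)
      = jet t G - (\<Sum>b'\<in>jet_index - {b}. fscale (jet t G b') (unit_fun b'))"
    by (simp add: algebra_simps)
  also have "\<dots> \<in> ?W"
    using G(1) by (intro FV.subspace_diff[OF W] FV.subspace_sum[OF W] term_in) auto
  finally have "fscale (1 / jet t G b) (fscale (jet t G b) (unit_fun b)) \<in> ?W"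
    by (rule FV.subspace_scale[OF W])
  then show ?case using G(2) by simp
qed

lemma hilbert_fun_fat_reg:
  "hilbert_fun n (fat_ideal n s P m) (fat_reg n s P m) = fat_multiplicity n s m"
  unfolding fat_reg_def using hilbert_fun_eq_iff jets_surjective by (rule_tac LeastI) blast

end

hide_const (open) module.smult Coset.order

section \<open>Pulling back forms to a rational normal curve\<close>

lemma comm_ring_hom_poly: "comm_ring_hom (\<lambda>p::'a::comm_ring_1 poly. poly p a)"
  by standard auto

lemma subst_cong:
  assumes "f \<in> carrier (mpoly_ring n)" "\<And>i. i \<le> n \<Longrightarrow> \<phi> i = \<chi> i"
  shows "subst h \<phi> f = subst h \<chi> f"
proof -
  have "monom_eval \<phi> \<alpha> = monom_eval \<chi> \<alpha>" if "\<alpha> \<in> Poly_Mapping.keys f" for \<alpha>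
    unfolding monom_eval_def
  proof (intro prod.cong refl)
    fix i assume "i \<in> Poly_Mapping.keys \<alpha>"
    then have "i \<le> n" using that assms(1) by (auto simp: mem_carrier_mpoly_ring)
    then show "\<phi> i ^ Poly_Mapping.lookup \<alpha> i = \<chi> i ^ Poly_Mapping.lookup \<alpha> i" by (simp add: assms(2))
  qed
  then show ?thesis by (simp add: subst_def)
qed

lemma poly_subst_pconst:
  assumes "f \<in> carrier (mpoly_ring n)" "\<And>i. i \<le> n \<Longrightarrow> poly (\<psi> i) a = x $ i"
  shows "poly (subst (\<lambda>c. [:c:]) \<psi> f) a = mpoly_eval f x"
proof -
  have "poly (subst (\<lambda>c. [:c:]) \<psi> f) a = subst (\<lambda>c. c) (\<lambda>i. poly (\<psi> i) a) f"
    by (subst hom_subst[OF comm_ring_hom_poly]) simp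
  also have "\<dots> = mpoly_eval f x"
    unfolding mpoly_eval_eq_subst by (rule subst_cong[OF assms])
  finally show ?thesis .
qed

text \<open>Each monomial becomes a product of \<open>t\<close> polynomials of degree at most
  \<open>j\<close>.\<close>

lemma degree_subst_form:
  fixes \<psi> :: "nat \<Rightarrow> 'a::comm_ring_1 poly"
  assumes f: "f \<in> forms n t" and \<psi>: "\<And>i. i \<le> n \<Longrightarrow> degree (\<psi> i) \<le> j"
  shows "degree (subst (\<lambda>c. [:c:]) \<psi> f) \<le> t * j"
  unfolding subst_def
proof (rule degree_sum_le)
  fix \<alpha> assume "\<alpha> \<in> Poly_Mapping.keys f"
  then have \<alpha>: "Poly_Mapping.keys \<alpha> \<subseteq> {..n}" "monom_degree \<alpha> = t" using f by (auto simp: forms_iff)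
  have "degree (monom_eval \<psi> \<alpha>) \<le> (\<Sum>i\<in>Poly_Mapping.keys \<alpha>. degree (\<psi> i ^ Poly_Mapping.lookup \<alpha> i))"
    unfolding monom_eval_def by (rule order_trans[OF degree_prod_sum_le]) auto
  also have "\<dots> \<le> (\<Sum>i\<in>Poly_Mapping.keys \<alpha>. Poly_Mapping.lookup \<alpha> i * j)"
  proof (rule sum_mono)
    fix i assume "i \<in> Poly_Mapping.keys \<alpha>"
    then have "degree (\<psi> i) \<le> j" using \<alpha> \<psi> by auto
    then have "degree (\<psi> i) * Poly_Mapping.lookup \<alpha> i \<le> j * Poly_Mapping.lookup \<alpha> i"
      by (rule mult_right_mono) simp
    also have "\<dots> = Poly_Mapping.lookup \<alpha> i * j" by (rule mult.commute)
    finally show "degree (\<psi> i ^ Poly_Mapping.lookup \<alpha> i) \<le> Poly_Mapping.lookup \<alpha> i * j"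
      by (rule order_trans[OF degree_power_le])
  qed
  also have "\<dots> = t * j" using \<alpha>(2) by (simp add: monom_degree_def flip: sum_distrib_right)
  finally show "degree ([:Poly_Mapping.lookup f \<alpha>:] * monom_eval \<psi> \<alpha>) \<le> t * j"
    using degree_smult_le[of "Poly_Mapping.lookup f \<alpha>" "monom_eval \<psi> \<alpha>"] by simp
qed simp

lemma sum_order_le_degree:
  fixes p :: "'a::idom poly"
  assumes "p \<noteq> 0" "finite A"
  shows "(\<Sum>a\<in>A. order a p) \<le> degree p"
proof -
  have "(\<Sum>a\<in>A. order a p) = (\<Sum>a\<in>A \<inter> {a. poly p a = 0}. order a p)"
    using assms by (intro sum.mono_neutral_right) (auto simp: order_root)
  also have "\<dots> \<le> (\<Sum>a\<in>{a. poly p a = 0}. order a p)"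
    using assms by (intro sum_mono2) (auto simp: poly_roots_finite)
  also have "\<dots> = size (proots p)"
    using assms by (simp add: size_multiset_overloaded_eq set_count_proots)
  also have "\<dots> \<le> degree p" by (rule size_proots_le)
  finally show ?thesis .
qed

text \<open>The curve in the parametrisation \<open>(t, u) = (1 + e x, x)\<close>; by the choice of \<open>e\<close> no point of
  interest has parameter \<open>x = \<infinity>\<close>. The matrix \<open>B\<close> undoes the change of coordinates.\<close>

definition rnc_coord :: "nat \<Rightarrow> 'a::field \<Rightarrow> nat \<Rightarrow> 'a poly" where
  "rnc_coord j e l = [:1, e:] ^ (j - l) * [:0, 1:] ^ l"

definition curve :: "'a::field mat \<Rightarrow> nat \<Rightarrow> 'a \<Rightarrow> nat \<Rightarrow> 'a poly" where
  "curve B j e i = (\<Sum>l\<le>j. smult (B $$ (i, l)) (rnc_coord j e l))"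

lemma degree_curve: "degree (curve B j e i) \<le> j"
  unfolding curve_def
proof (rule degree_sum_le)
  fix l assume "l \<in> {..j}"
  then have l: "l \<le> j" by simp
  have "degree ([:1, e:] ^ (j - l)) \<le> 1 * (j - l)"
    by (rule order_trans[OF degree_power_le mult_right_mono]) auto
  moreover have "degree ([:0, 1:] ^ l :: 'a poly) \<le> 1 * l"
    by (rule order_trans[OF degree_power_le mult_right_mono]) auto
  ultimately have "degree (rnc_coord j e l) \<le> j"
    unfolding rnc_coord_def using l by (intro order_trans[OF degree_mult_le]) simp
  then show "degree (smult (B $$ (i, l)) (rnc_coord j e l)) \<le> j"
    using degree_smult_le order_trans by blast
qed simp

lemma poly_rnc_coord: "poly (rnc_coord j e l) a = (1 + e * a) ^ (j - l) * a ^ l"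
  by (simp add: rnc_coord_def algebra_simps)

lemma poly_curve:
  assumes B: "B \<in> carrier_mat (n + 1) (n + 1)" and "i \<le> n" "j \<le> n"
  shows "poly (curve B j e i) a = (B *\<^sub>v rnc_vec n j (1 + e * a) a) $ i"
proof -
  have "(B *\<^sub>v rnc_vec n j (1 + e * a) a) $ i =
      (\<Sum>l = 0..<n + 1. B $$ (i, l) * (if l \<le> j then (1 + e * a) ^ (j - l) * a ^ l else 0))"
    using assms by (simp add: rnc_vec_def scalar_prod_def)
  also have "\<dots> = (\<Sum>l\<le>j. B $$ (i, l) * ((1 + e * a) ^ (j - l) * a ^ l))"
    using assms by (intro sum.mono_neutral_cong_right) auto
  finally show ?thesis by (simp add: curve_def poly_sum poly_rnc_coord)
qed

section \<open>Tangents of the curve and choice of parameters\<close>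

lemma smult_sum_right: "smult a (\<Sum>i\<in>A. p i) = (\<Sum>i\<in>A. smult a (p i))"
  by (induction A rule: infinite_finite_induct) (auto simp: smult_add_right)

text \<open>Applying \<open>A\<close> to the moved curve recovers the standard one, so divisibility
  statements about the moved coordinates carry over to \<open>rnc_coord\<close>.\<close>

lemma curve_coords:
  assumes A: "A \<in> carrier_mat (n + 1) (n + 1)" and B: "B \<in> carrier_mat (n + 1) (n + 1)"
    and AB: "A * B = 1\<^sub>m (n + 1)" and r: "r \<le> j" "j \<le> n"
  shows "(\<Sum>i\<le>n. smult (A $$ (r, i)) (curve B j e i)) = rnc_coord j e r"
proof -
  have ent: "(\<Sum>i\<le>n. A $$ (r, i) * B $$ (i, l)) = (if r = l then 1 else 0)" if "l \<le> j" for l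
  proof -
    have "(A * B) $$ (r, l) = (\<Sum>i = 0..<n + 1. A $$ (r, i) * B $$ (i, l))"
      using A B r that by (simp add: scalar_prod_def)
    moreover have "(A * B) $$ (r, l) = (if r = l then 1 else 0)" using AB r that by simp
    moreover have "{0..<n + 1} = {..n}" by auto
    ultimately show ?thesis by simp
  qed
  have "(\<Sum>i\<le>n. smult (A $$ (r, i)) (curve B j e i))
      = (\<Sum>i\<le>n. \<Sum>l\<le>j. smult (A $$ (r, i) * B $$ (i, l)) (rnc_coord j e l))"
    by (simp add: curve_def smult_sum_right)
  also have "\<dots> = (\<Sum>l\<le>j. \<Sum>i\<le>n. smult (A $$ (r, i) * B $$ (i, l)) (rnc_coord j e l))"
    by (rule sum.swap)
  also have "\<dots> = (\<Sum>l\<le>j. smult (\<Sum>i\<le>n. A $$ (r, i) * B $$ (i, l)) (rnc_coord j e l))"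
    by (simp add: smult_sum)
  also have "\<dots> = (\<Sum>l\<le>j. if r = l then rnc_coord j e l else 0)"
    by (intro sum.cong) (auto simp: ent)
  also have "\<dots> = rnc_coord j e r" using r by simp
  finally show ?thesis .
qed

text \<open>The curve is smooth: some chart linear form has a simple zero along it. If not, then
  \<open>w\<^sub>p(a) w\<^sub>r - w\<^sub>r(a) w\<^sub>p\<close> vanishes doubly at \<open>a\<close> for all coordinates \<open>w\<^sub>p, w\<^sub>r\<close> of the
  standard curve, which fails for one of the pairs \<open>(0, 1)\<close> and \<open>(j, j - 1)\<close>.\<close>

lemma curve_transversal:
  assumes A: "A \<in> carrier_mat (n + 1) (n + 1)" and B: "B \<in> carrier_mat (n + 1) (n + 1)"
    and AB: "A * B = 1\<^sub>m (n + 1)" and j: "1 \<le> j" "j \<le> n"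
    and c: "c \<le> n" "v $ c = 1" and \<kappa>: "\<kappa> \<noteq> 0"
    and point: "\<And>i. i \<le> n \<Longrightarrow> poly (curve B j e i) a = \<kappa> * v $ i"
  obtains l where "l \<le> n" "l \<noteq> c"
    "\<not> [:- a, 1:] ^ 2 dvd curve B j e l - smult (v $ l) (curve B j e c)"
proof (rule ccontr)
  note witness = that
  assume "\<not> thesis"
  let ?D = "[:- a, 1:] ^ 2" and ?\<psi> = "curve B j e" and ?w = "rnc_coord j e"
  have *: "?D dvd ?\<psi> i - smult (v $ i) (?\<psi> c)" if "i \<le> n" for i
    using \<open>\<not> thesis\<close> witness[OF that] c by (cases "i = c") auto
  \<comment> \<open>The coordinates of \<open>A\<close> applied to \<open>v\<close>: modulo the
    double zero, every standard coordinate is \<open>\<alpha> r\<close> times the one polynomial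
    \<open>?\<psi> c\<close>.\<close>
  define \<alpha> where "\<alpha> r = (\<Sum>i\<le>n. A $$ (r, i) * v $ i)" for r
  have w_dvd: "?D dvd ?w r - smult (\<alpha> r) (?\<psi> c)" if "r \<le> j" for r
  proof -
    have "?w r - smult (\<alpha> r) (?\<psi> c) = (\<Sum>i\<le>n. smult (A $$ (r, i)) (?\<psi> i - smult (v $ i) (?\<psi> c)))"
      using curve_coords[OF A B AB that j(2), of e]
      by (simp add: smult_diff_right sum_subtractf \<alpha>_def smult_sum)
    then show ?thesis using * by (auto intro!: dvd_sum dvd_smult)
  qed
  have w_val: "poly (?w r) a = \<alpha> r * \<kappa>" if "r \<le> j" for r
  proof -
    have "[:- a, 1:] dvd ?D" by (rule dvd_power) simp
    then have "[:- a, 1:] dvd ?w r - smult (\<alpha> r) (?\<psi> c)" using w_dvd[OF that] dvd_trans by blast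
    then show ?thesis using point[OF c(1)] c(2) by (simp add: poly_eq_0_iff_dvd[symmetric])
  qed
  \<comment> \<open>With weights \<open>\<alpha> p * \<kappa>\<close> and
    \<open>\<alpha> r * \<kappa>\<close> the multiples of \<open>?\<psi> c\<close> cancel.\<close>
  have wr: "?D dvd smult (poly (?w p) a) (?w r) - smult (poly (?w r) a) (?w p)" if "p \<le> j" "r \<le> j" for p r
  proof -
    have "smult (poly (?w p) a) (?w r) - smult (poly (?w r) a) (?w p) =
      smult (poly (?w p) a) (?w r - smult (\<alpha> r) (?\<psi> c)) - smult (poly (?w r) a) (?w p - smult (\<alpha> p) (?\<psi> c))"
      unfolding w_val[OF that(1)] w_val[OF that(2)]
      by (simp add: smult_diff_right mult_ac)
    then show ?thesis using w_dvd[OF that(1)] w_dvd[OF that(2)] by (simp add: dvd_diff dvd_smult)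
  qed
  have root: "poly q a = 0" if "?D dvd q * [:- a, 1:]" for q
  proof -
    have "[:- a, 1:] * [:- a, 1:] dvd q * [:- a, 1:]" using that by (simp only: power2_eq_square)
    then have "[:- a, 1:] dvd q" by (subst (asm) dvd_times_right_cancel_iff) auto
    then show ?thesis by (simp add: poly_eq_0_iff_dvd)
  qed
  define S where "S = [:1, e:]"
  define X where "X = [:0, 1 :: 'a:]"
  define \<sigma> where "\<sigma> = 1 + e * a"
  obtain j' where j': "j = Suc j'" using j(1) by (cases j) auto
  have w_eq: "?w l = S ^ (j - l) * X ^ l" for l
    by (simp only: rnc_coord_def S_def X_def)
  have w_at: "poly (?w l) a = \<sigma> ^ (j - l) * a ^ l" for l
    by (simp only: poly_rnc_coord \<sigma>_def)
  \<comment> \<open>The parametrisation (1 + e x, x) is chosen so that this determinant is x - a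
    with coefficient 1, for every e.\<close>
  have lin: "smult \<sigma> X - smult a S = [:- a, 1:]" by (simp add: \<sigma>_def S_def X_def)
  have wronskian: "smult (\<alpha> * \<sigma>) (Q * X) - smult (\<alpha> * a) (Q * S) = smult \<alpha> Q * [:- a, 1:]" for \<alpha> Q
    unfolding lin[symmetric] by (simp add: right_diff_distrib mult.commute)
  have "smult (poly (?w 0) a) (?w 1) - smult (poly (?w 1) a) (?w 0)
      = smult (\<sigma> ^ j' * \<sigma>) (S ^ j' * X) - smult (\<sigma> ^ j' * a) (S ^ j' * S)"
    unfolding w_at unfolding w_eq by (simp add: j' One_nat_def mult.commute)
  then have "?D dvd smult (\<sigma> ^ j') (S ^ j') * [:- a, 1:]" using wr[of 0 1] j(1) unfolding wronskian by simp
  \<comment> \<open>At \<open>a\<close> the cofactor takes the value \<sigma>^(2j'). For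
    \<open>j = 1\<close> this value is 1, so the contradiction arises already here.\<close>
  from root[OF this] have \<sigma>0: "\<sigma> = 0" by (simp add: S_def \<sigma>_def mult.commute)
  have "smult (poly (?w j') a) (?w j) - smult (poly (?w j) a) (?w j')
      = smult (a ^ j' * \<sigma>) (X ^ j' * X) - smult (a ^ j' * a) (X ^ j' * S)"
    unfolding w_at unfolding w_eq by (simp add: j' mult.commute)
  then have "?D dvd smult (a ^ j') (X ^ j') * [:- a, 1:]" using wr[of j' j] j' unfolding wronskian by simp
  from root[OF this] have "a = 0" by (simp add: X_def)
  with \<sigma>0 show False by (simp add: \<sigma>_def)
qed

lemma invertible_mat_inverse:
  assumes A: "A \<in> carrier_mat N N" and "invertible_mat A"
  obtains B where "B \<in> carrier_mat N N" "A * B = 1\<^sub>m N" "B * A = 1\<^sub>m N"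
proof -
  from assms obtain B where AB: "A * B = 1\<^sub>m N" and BA: "B * A = 1\<^sub>m (dim_row B)"
    by (auto simp: invertible_mat_def inverts_mat_def)
  have "dim_col B = N" using arg_cong[OF AB, of dim_col] by simp
  moreover have "dim_row B = N" using arg_cong[OF BA, of dim_col] A by simp
  ultimately show thesis using AB BA by (intro that[of B]) auto
qed

text \<open>The coordinates are homogeneous of degree \<open>j\<close> in the parameters, so
  parameters may be rescaled without moving the point.\<close>

lemma rnc_vec_scale:
  assumes "d \<noteq> 0"
  shows "rnc_vec n j (t / d) (u / d) = (1 / d ^ j) \<cdot>\<^sub>v rnc_vec n j t u"
proof (rule eq_vecI)
  fix i assume "i < dim_vec ((1 / d ^ j) \<cdot>\<^sub>v rnc_vec n j t u)"
  then have i: "i < n + 1" by (simp add: rnc_vec_def)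
  have "(t / d) ^ (j - i) * (u / d) ^ i = t ^ (j - i) * u ^ i / d ^ j" if "i \<le> j"
    using that by (simp add: power_divide flip: power_add)
  then show "rnc_vec n j (t / d) (u / d) $ i = ((1 / d ^ j) \<cdot>\<^sub>v rnc_vec n j t u) $ i"
    using i by (auto simp: rnc_vec_def)
qed (simp add: rnc_vec_def)

text \<open>Any \<open>e\<close> different from the finitely many ratios \<open>t/u\<close> will do.\<close>

lemma rnc_parameters:
  fixes P :: "'i \<Rightarrow> 'a::field vec set"
  assumes inf: "infinite (UNIV :: 'a set)" and T: "finite T"
    and normalized: "\<And>i. i \<in> T \<Longrightarrow> normalized_at n (P i) (c i) (v i)"
    and B: "B \<in> carrier_mat (n + 1) (n + 1)" and A: "A \<in> carrier_mat (n + 1) (n + 1)"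
    and BA: "B * A = 1\<^sub>m (n + 1)"
    and rnc: "\<And>i. i \<in> T \<Longrightarrow> \<exists>t u. (t, u) \<noteq> (0, 0) \<and> rnc_vec n j t u \<in> (\<lambda>v. A *\<^sub>v v) ` P i"
  shows "\<exists>e a. \<forall>i\<in>T. B *\<^sub>v rnc_vec n j (1 + e * a i) (a i) \<in> P i"
proof -
  have "\<exists>t. \<forall>i\<in>T. \<exists>u. (t i, u) \<noteq> (0, 0) \<and> rnc_vec n j (t i) u \<in> (\<lambda>v. A *\<^sub>v v) ` P i"
    using rnc by (intro bchoice) auto
  then obtain t where "\<forall>i\<in>T. \<exists>u. (t i, u) \<noteq> (0, 0) \<and> rnc_vec n j (t i) u \<in> (\<lambda>v. A *\<^sub>v v) ` P i" by blast
  from bchoice[OF this] obtain u where tu: "\<And>i. i \<in> T \<Longrightarrow> (t i, u i) \<noteq> (0, 0)"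
    and mem: "\<And>i. i \<in> T \<Longrightarrow> rnc_vec n j (t i) (u i) \<in> (\<lambda>v. A *\<^sub>v v) ` P i" by blast
  obtain e where e: "e \<notin> (\<lambda>i. t i / u i) ` T"
    using ex_new_if_finite[OF inf finite_imageI[OF T]] by blast
  \<comment> \<open>Division by d = t - e u brings (t, u) into the form (1 + e a, a) with a = u/d.
    The choice of \<open>e\<close> gives d nonzero when u is nonzero; when u = 0, d is t, which is
    then nonzero.\<close>
  define d where "d i = t i - e * u i" for i
  have d: "d i \<noteq> 0" if "i \<in> T" for i
  proof
    assume "d i = 0"
    then have "t i = e * u i" by (simp add: d_def)
    then show False using tu[OF that] e that by (cases "u i = 0") force+
  qed
  show ?thesis
  proof (rule exI[of _ e], rule exI[of _ "\<lambda>i. u i / d i"], rule ballI)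
    fix i assume i: "i \<in> T"
    obtain q where q: "q \<in> P i" "rnc_vec n j (t i) (u i) = A *\<^sub>v q" using mem[OF i] by blast
    have vi: "v i \<in> carrier_vec (n + 1)" by (rule normalized_atD(2)[OF normalized[OF i]])
    obtain k where k: "k \<noteq> 0" "q = k \<cdot>\<^sub>v v i" by (rule normalized_atE[OF normalized[OF i] q(1)])
    have q_carr: "q \<in> carrier_vec (n + 1)" using k vi by simp
    have "1 + e * (u i / d i) = t i / d i" using d[OF i] by (simp add: d_def field_simps)
    then have "B *\<^sub>v rnc_vec n j (1 + e * (u i / d i)) (u i / d i) = B *\<^sub>v ((1 / d i ^ j) \<cdot>\<^sub>v (A *\<^sub>v q))"
      using rnc_vec_scale[OF d[OF i]] q(2) by simp
    also have "\<dots> = (1 / d i ^ j) \<cdot>\<^sub>v (B *\<^sub>v (A *\<^sub>v q))"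
      by (rule mult_mat_vec[OF B]) (use A q_carr in simp)
    also have "B *\<^sub>v (A *\<^sub>v q) = q"
      using assoc_mult_mat_vec[OF B A q_carr] BA q_carr by simp
    also have "(1 / d i ^ j) \<cdot>\<^sub>v q = (1 / d i ^ j * k) \<cdot>\<^sub>v v i" using k by (simp add: smult_smult_assoc)
    finally show "B *\<^sub>v rnc_vec n j (1 + e * (u i / d i)) (u i / d i) \<in> P i"
      using normalized_at_smult_mem[OF normalized[OF i], of "1 / d i ^ j * k"] d[OF i] k(1) by simp
  qed
qed

section \<open>Counting zeros along the curve\<close>

context fat_points
begin

text \<open>The condition \<open>surj\<close> is, by \<open>hilbert_fun_eq_iff\<close>, that the
  Hilbert function equals the multiplicity at \<open>t\<close>; the bound holds in every such
  degree.\<close>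

lemma rnc_degree_bound:
  assumes inf: "infinite (UNIV :: 'a set)" and j: "1 \<le> j" "j \<le> n"
    and T: "T \<subseteq> {1..s}" "T \<noteq> {}" and rnc: "in_Rnc n j (P ` T)"
    and surj: "\<And>b. b \<in> jet_index \<Longrightarrow> unit_fun b \<in> jet t ` forms n t"
  shows "(\<Sum>i\<in>T. m i) \<le> t * j + 1"
proof -
  obtain A where A: "A \<in> carrier_mat (n + 1) (n + 1)" "invertible_mat A"
    and A_rnc: "\<And>i. i \<in> T \<Longrightarrow> \<exists>t u. (t, u) \<noteq> (0, 0) \<and> rnc_vec n j t u \<in> (\<lambda>v. A *\<^sub>v v) ` P i"
    using rnc by (auto simp: in_Rnc_def)
  obtain B where B: "B \<in> carrier_mat (n + 1) (n + 1)" "A * B = 1\<^sub>m (n + 1)" "B * A = 1\<^sub>m (n + 1)"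
    using invertible_mat_inverse[OF A] by blast
  have finT: "finite T" using T(1) finite_subset by blast
  have norm_T: "normalized_at n (P i) (c i) (v i)" if "i \<in> T" for i
    using that T(1) by (intro normalized) blast
  obtain e a where on_curve: "\<forall>i\<in>T. B *\<^sub>v rnc_vec n j (1 + e * a i) (a i) \<in> P i"
  proof -
    have "\<exists>e a. \<forall>i\<in>T. B *\<^sub>v rnc_vec n j (1 + e * a i) (a i) \<in> P i"
      using inf finT norm_T B(1) A(1) B(3) A_rnc by (rule rnc_parameters)
    then show thesis using that by (elim exE)
  qed
  define \<psi> where "\<psi> = curve B j e"
  define x where "x i = B *\<^sub>v rnc_vec n j (1 + e * a i) (a i)" for i
  have x_in: "x i \<in> P i" if "i \<in> T" for i using bspec[OF on_curve that] by (simp only: x_def)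
  have poly_\<psi>: "poly (\<psi> l) (a i) = x i $ l" if "l \<le> n" for i l
    unfolding \<psi>_def x_def by (rule poly_curve[OF B(1) that j(2)])
  \<comment> \<open>The parameter fixes a coordinate vector and hence the point, so zeros at
    different points are counted separately in the degree.\<close>
  have inj_a: "inj_on a T"
  proof (rule inj_onI)
    fix i k assume ik: "i \<in> T" "k \<in> T" "a i = a k"
    then have "x i = x k" by (simp add: x_def)
    then have "x i \<in> P k" using x_in[OF ik(2)] by simp
    then have "P i = P k" by (rule normalized_at_eqI[OF norm_T norm_T x_in, OF ik(1) ik(2) ik(1)])
    moreover have "i \<in> {1..s}" "k \<in> {1..s}" using ik T(1) by blast+
    ultimately show "i = k" using inj_onD[OF inj_P] by blast
  qed
  interpret H: comm_ring_hom "subst (\<lambda>c. [:c:]) \<psi>"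
    by (rule comm_ring_hom.comm_ring_hom_subst[OF comm_ring_hom_pconst])
  let ?H = "subst (\<lambda>c. [:c:]) \<psi>"
  \<comment> \<open>The filtration lemma for K[x] with powers of x - a_i: a form vanishing on
    \<open>P i\<close> vanishes at \<open>x i\<close>, so its restriction has the root
    \<open>a i\<close>.\<close>
  have pow_dvd: "[:- a i, 1:] ^ q dvd ?H f"
    if "i \<in> T" "f \<in> point_ideal n (P i) [^]\<^bsub>ideals_set (mpoly_ring n)\<^esub> q" for i q f
  proof -
    have "?H f \<in> {p. [:- a i, 1:] ^ q dvd p}"
    proof (rule point_ideal_pow_filtration[OF ring_filtration_dvd H.comm_ring_hom_axioms _ that(2)])
      fix f d assume f: "f \<in> forms n d" and z: "\<And>v. v \<in> P i \<Longrightarrow> mpoly_eval f v = 0"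
      have "poly (?H f) (a i) = mpoly_eval f (x i)"
        by (rule poly_subst_pconst[OF forms_in_carrier[OF f] poly_\<psi>])
      then show "?H f \<in> {p. [:- a i, 1:] ^ 1 dvd p}"
        using z[OF x_in[OF that(1)]] by (simp add: poly_eq_0_iff_dvd)
    qed
    then show ?thesis by simp
  qed
  obtain k where k: "k \<in> T" using T(2) by blast
  then have ks: "k \<in> {1..s}" using T(1) by blast
  let ?c = "c k" and ?v = "v k" and ?q = "[:- a k, 1:]"
  note ck = normalized_atD(1,4)[OF normalized[OF ks]]
    and dim_v = normalized_atD(3)[OF normalized[OF ks]]
  obtain \<kappa> where \<kappa>: "\<kappa> \<noteq> 0" "x k = \<kappa> \<cdot>\<^sub>v ?v"
    by (rule normalized_atE[OF normalized[OF ks] x_in[OF k]])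
  have point: "poly (\<psi> i) (a k) = \<kappa> * ?v $ i" if "i \<le> n" for i
    using poly_\<psi>[OF that, of k] \<kappa>(2) dim_v that by simp
  obtain l where l: "l \<le> n" "l \<noteq> ?c" "\<not> ?q ^ 2 dvd \<psi> l - smult (?v $ l) (\<psi> ?c)"
    unfolding \<psi>_def
    by (rule curve_transversal[OF A(1) B(1,2) j ck \<kappa>(1) point[unfolded \<psi>_def]])
  define \<beta> where "\<beta> = Poly_Mapping.single l (m k - 1)"
  have \<beta>: "\<beta> \<in> local_exps n ?c (m k)" "monom_degree \<beta> = m k - 1"
    using l m_pos[OF ks] by (auto simp: \<beta>_def local_exps_def)
  then have "(k, \<beta>) \<in> jet_index" using ks by (simp add: jet_index_def)
  with surj obtain F where F: "F \<in> forms n t" "jet t F = unit_fun (k, \<beta>)" by fastforce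
  have jetF: "Poly_Mapping.lookup (shift (c i) (v i) F) (\<gamma> + Poly_Mapping.single (c i) (t - monom_degree \<gamma>))
      = (if i = k \<and> \<gamma> = \<beta> then 1 else 0)"
    if "i \<in> {1..s}" "\<gamma> \<in> local_exps n (c i) (m i)" for i \<gamma>
    using fun_cong[OF F(2), of "(i, \<gamma>)"] that by (simp add: jet_def jet_index_def unit_fun_def)
  have F_other: "?H F \<in> {p. [:- a i, 1:] ^ m i dvd p}" if "i \<in> T - {k}" for i
  proof -
    have i: "i \<in> {1..s}" using that T(1) by blast
    have "F \<in> point_ideal n (P i) [^]\<^bsub>ideals_set (mpoly_ring n)\<^esub> m i"
      unfolding form_in_pow_iff_lookup[OF normalized[OF i] F(1)] using jetF[OF i] that by auto
    then show ?thesis using pow_dvd[of i] that by simp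
  qed
  define \<gamma>\<^sub>0 where "\<gamma>\<^sub>0 = \<beta> + Poly_Mapping.single ?c (t - monom_degree \<beta>)"
  define F\<^sub>0 where "F\<^sub>0 = subst (Poly_Mapping.single 0) (chart ?c ?v) (Poly_Mapping.single \<gamma>\<^sub>0 1)"
  \<comment> \<open>A nonzero coefficient of a form of degree \<open>t\<close> forces
    \<open>\<gamma>\<^sub>0\<close> to have degree \<open>t\<close>; this gives
    \<open>m k - 1 \<le> t\<close>, so the subtraction in \<open>\<gamma>\<^sub>0\<close> was not
    truncated.\<close>
  have "Poly_Mapping.lookup (shift ?c ?v F) \<gamma>\<^sub>0 \<noteq> 0"
    using jetF[OF ks \<beta>(1)] by (simp add: \<gamma>\<^sub>0_def)
  then have \<gamma>\<^sub>0: "Poly_Mapping.keys \<gamma>\<^sub>0 \<subseteq> {..n}" "monom_degree \<gamma>\<^sub>0 = t"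
    using shift_form[OF ck(1) F(1), of ?v] by (auto simp: forms_iff in_keys_iff)
  have F\<^sub>0_form: "F\<^sub>0 \<in> forms n t"
    unfolding F\<^sub>0_def using \<gamma>\<^sub>0 by (intro forms_subst chart_form ck) (auto simp: forms_iff)
  interpret sh: comm_ring_hom "shift ?c ?v" by (rule comm_ring_hom_shift)
  \<comment> \<open>Both forms have the same jet at \<open>P k\<close>. Terms of F of higher order
    there are unknown, but only \<open>F\<^sub>0\<close> has to be restricted explicitly.\<close>
  have "F - F\<^sub>0 \<in> point_ideal n (P k) [^]\<^bsub>ideals_set (mpoly_ring n)\<^esub> m k"
    unfolding form_in_pow_iff_lookup[OF normalized[OF ks] forms_diff[OF F(1) F\<^sub>0_form]]
  proof
    fix \<gamma> assume \<gamma>: "\<gamma> \<in> local_exps n ?c (m k)"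
    have "\<gamma>\<^sub>0 = \<gamma> + Poly_Mapping.single ?c (t - monom_degree \<gamma>) \<longleftrightarrow> \<gamma> = \<beta>"
    proof
      assume "\<gamma>\<^sub>0 = \<gamma> + Poly_Mapping.single ?c (t - monom_degree \<gamma>)"
      then have "\<gamma> + Poly_Mapping.single ?c (t - monom_degree \<gamma>)
          = \<beta> + Poly_Mapping.single ?c (t - monom_degree \<beta>)"
        by (simp only: \<gamma>\<^sub>0_def)
      then show "\<gamma> = \<beta>"
        using \<gamma> \<beta>(1) by (intro local_monomial_inj[of \<gamma> n ?c \<beta>]) (auto simp: local_exps_def)
    qed (simp add: \<gamma>\<^sub>0_def)
    then show "Poly_Mapping.lookup (shift ?c ?v (F - F\<^sub>0)) (\<gamma> + Poly_Mapping.single ?c (t - monom_degree \<gamma>)) = 0"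
      using jetF[OF ks \<gamma>]
      by (simp add: sh.hom_minus lookup_minus F\<^sub>0_def shift_subst_chart lookup_single when_def)
  qed
  then have diff_dvd: "?q ^ m k dvd ?H F - ?H F\<^sub>0"
    using pow_dvd[OF k] by (simp flip: H.hom_minus)
  define \<omega> where "\<omega> = \<psi> l - smult (?v $ l) (\<psi> ?c)"
  have H_chart: "?H (chart ?c ?v i) = (if i = ?c then \<psi> ?c else \<psi> i - smult (?v $ i) (\<psi> ?c))" for i
    by (simp add: chart_def H.hom_minus H.hom_mult comm_ring_hom.subst_mvar[OF comm_ring_hom_pconst]
        comm_ring_hom.subst_const[OF comm_ring_hom_pconst])
  have HF\<^sub>0: "?H F\<^sub>0 = \<omega> ^ (m k - 1) * \<psi> ?c ^ (t - monom_degree \<beta>)"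
    unfolding F\<^sub>0_def subst_subst[OF comm_ring_hom_pconst] comm_ring_hom.subst_single[OF comm_ring_hom_pconst]
    using l(2) by (simp add: \<gamma>\<^sub>0_def monom_eval_add \<beta>_def H_chart \<omega>_def one_pCons[symmetric])
  have "poly \<omega> (a k) = 0" using point[OF l(1)] point[OF ck(1)] ck(2) by (simp add: \<omega>_def)
  then obtain \<rho> where \<rho>: "\<omega> = ?q * \<rho>" unfolding poly_eq_0_iff_dvd by (auto elim: dvdE)
  have \<rho>0: "poly \<rho> (a k) \<noteq> 0"
  proof
    assume "poly \<rho> (a k) = 0"
    then have "?q * ?q dvd \<omega>" unfolding poly_eq_0_iff_dvd \<rho> by (intro mult_dvd_mono) auto
    with l(3) show False by (simp only: \<omega>_def power2_eq_square)
  qed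
  have HF\<^sub>0': "?H F\<^sub>0 = ?q ^ (m k - 1) * (\<rho> ^ (m k - 1) * \<psi> ?c ^ (t - monom_degree \<beta>))"
    unfolding HF\<^sub>0 \<rho> by (simp only: power_mult_distrib mult.assoc)
  \<comment> \<open>Neither \<rho> nor \<open>\<psi> ?c\<close> vanishes at \<open>a k\<close>, so
    the restriction of \<open>F\<^sub>0\<close> has order exactly \<open>m k - 1\<close>; that of F
    differs from it by a multiple of the next power.\<close>
  have not_dvd: "\<not> ?q ^ m k dvd ?H F"
  proof
    assume "?q ^ m k dvd ?H F"
    then have "?q ^ m k dvd ?H F\<^sub>0" using dvd_diff[OF _ diff_dvd, of "?H F"] by simp
    moreover have "?q ^ m k = ?q ^ (m k - 1) * ?q" using m_pos[OF ks] by (cases "m k") (auto simp: mult.commute)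
    ultimately have "?q ^ (m k - 1) * ?q dvd
        ?q ^ (m k - 1) * (\<rho> ^ (m k - 1) * \<psi> ?c ^ (t - monom_degree \<beta>))"
      by (simp only: HF\<^sub>0')
    moreover have "?q \<noteq> 0" by simp
    ultimately have "?q dvd \<rho> ^ (m k - 1) * \<psi> ?c ^ (t - monom_degree \<beta>)"
      by (auto simp only: dvd_mult_cancel_left power_eq_0_iff)
    then have "poly (\<rho> ^ (m k - 1) * \<psi> ?c ^ (t - monom_degree \<beta>)) (a k) = 0"
      unfolding poly_eq_0_iff_dvd .
    then show False using \<rho>0 point[OF ck(1)] ck(2) \<kappa>(1) by simp
  qed
  then have HF_nz: "?H F \<noteq> 0" by auto
  have "?q ^ (m k - 1) dvd ?H F - ?H F\<^sub>0"
    by (rule dvd_trans[OF le_imp_power_dvd diff_dvd]) simp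
  moreover have "?q ^ (m k - 1) dvd ?H F\<^sub>0" unfolding HF\<^sub>0' by simp
  ultimately have "?q ^ (m k - 1) dvd ?H F" using dvd_add[of _ "?H F - ?H F\<^sub>0" "?H F\<^sub>0"] by simp
  then have "m k - 1 \<le> order (a k) (?H F)" using HF_nz by (simp add: order_divides)
  moreover have "(\<Sum>i\<in>T - {k}. m i) \<le> (\<Sum>i\<in>T - {k}. order (a i) (?H F))"
    using F_other HF_nz by (intro sum_mono) (auto simp: order_divides)
  moreover have "order (a k) (?H F) + (\<Sum>i\<in>T - {k}. order (a i) (?H F)) = (\<Sum>i\<in>T. order (a i) (?H F))"
    by (rule sum.remove[OF finT k, symmetric])
  moreover have "(\<Sum>i\<in>T. order (a i) (?H F)) = (\<Sum>y\<in>a ` T. order y (?H F))"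
    by (simp add: sum.reindex[OF inj_a])
  moreover have "\<dots> \<le> degree (?H F)"
    using finT by (intro sum_order_le_degree HF_nz) auto
  moreover have "degree (?H F) \<le> t * j"
    unfolding \<psi>_def by (intro degree_subst_form[OF F(1)] degree_curve)
  moreover have "(\<Sum>i\<in>T. m i) = m k + (\<Sum>i\<in>T - {k}. m i)"
    by (rule sum.remove[OF finT k])
  ultimately show ?thesis by linarith
qed

end

section \<open>Single points\<close>

text \<open>For the rank one matrix E with entries \<open>w i * f k\<close>, E E = (f w) E, so the
  matrices 1 + p E are closed under products. This yields an explicit inverse below.\<close>

lemma rank_one_update_mult:
  fixes w f :: "nat \<Rightarrow> 'a::comm_ring_1" and N :: nat
  defines "M \<equiv> \<lambda>p. mat N N (\<lambda>(i, k). (if i = k then 1 else 0) + p * w i * f k)"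
  shows "M p * M q = M (p + q + p * q * (\<Sum>k<N. f k * w k))"
proof (rule eq_matI)
  fix i j assume "i < dim_row (M (p + q + p * q * (\<Sum>k<N. f k * w k)))"
    "j < dim_col (M (p + q + p * q * (\<Sum>k<N. f k * w k)))"
  then have ij: "i < N" "j < N" by (simp_all add: M_def)
  have "(M p * M q) $$ (i, j) = (\<Sum>k<N. ((if i = k then 1 else 0) + p * w i * f k) *
      ((if k = j then 1 else 0) + q * w k * f j))"
    using ij by (simp add: M_def scalar_prod_def atLeast0LessThan)
  also have "\<dots> = (\<Sum>k<N. (if i = k then (if k = j then 1 else 0) + q * w k * f j else 0)
      + (if k = j then p * w i * f k else 0) + p * q * w i * f j * (f k * w k))"
    by (intro sum.cong) (auto simp: algebra_simps)
  also have "\<dots> = (if i = j then 1 else 0) + q * w i * f j + p * w i * f j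
      + p * q * w i * f j * (\<Sum>k<N. f k * w k)"
    using ij by (simp add: sum.distrib sum_distrib_left)
  finally show "(M p * M q) $$ (i, j) = M (p + q + p * q * (\<Sum>k<N. f k * w k)) $$ (i, j)"
    using ij by (simp add: M_def algebra_simps)
qed (simp_all add: M_def)

text \<open>A map \<open>x \<mapsto> x + f(x) (e\<^sub>0 - v)\<close> with \<open>f(v) = 1\<close> and \<open>f(e\<^sub>0) \<noteq> 0\<close> moves \<open>v\<close> to the point of
  the curve with parameter \<open>(1, 0)\<close>. Without this, \<open>rnc_bound\<close> might be an unspecified \<open>Max {}\<close>.\<close>

lemma single_point_in_Rnc:
  fixes Q :: "'a::field vec set"
  assumes Q: "normalized_at n Q c v"
  shows "in_Rnc n j {Q}"
proof -
  have c: "c \<le> n" "v $ c = 1" and v: "v \<in> carrier_vec (n + 1)" using normalized_atD[OF Q] by auto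
  \<comment> \<open>If the entry \<open>v $ 0\<close> is nonzero, scaling that coordinate works;
    otherwise \<open>c\<close> is not 0, and x_0 + x_c has value 1 both at \<open>v\<close> and at
    e_0.\<close>
  define f :: "nat \<Rightarrow> 'a" where
    "f = (if v $ 0 \<noteq> 0 then (\<lambda>k. if k = 0 then 1 / v $ 0 else 0)
          else (\<lambda>k. (if k = 0 then 1 else 0) + (if k = c then 1 else 0)))"
  define w where "w i = (if i = 0 then 1 else 0) - v $ i" for i
  define M where "M p = mat (n + 1) (n + 1) (\<lambda>(i, k). (if i = k then 1 else 0) + p * w i * f k)" for p
  have fv: "(\<Sum>k<n + 1. f k * v $ k) = 1"
    using c by (auto simp: f_def sum.distrib distrib_right if_distrib[of "\<lambda>x. x * _"] cong: if_cong)
  have f0: "f 0 \<noteq> 0" using c by (auto simp: f_def)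
  have fw: "(\<Sum>k<n + 1. f k * w k) = f 0 - 1"
    using fv by (simp add: w_def right_diff_distrib sum_subtractf if_distrib[of "\<lambda>x. _ * x"] cong: if_cong)
  have M0: "M 0 = 1\<^sub>m (n + 1)" by (rule eq_matI) (auto simp: M_def)
  have MM: "M p * M q = M (p + q + p * q * (f 0 - 1))" for p q
    unfolding M_def by (subst rank_one_update_mult) (simp only: fw)
  \<comment> \<open>For p = 1 the equation p + q + p q (f(e_0) - 1) = 0 reads 1 + q f(e_0) =
    0.\<close>
  have "1 + - 1 / f 0 + 1 * (- 1 / f 0) * (f 0 - 1) = 0" "- 1 / f 0 + 1 + - 1 / f 0 * 1 * (f 0 - 1) = 0"
    using f0 by (simp_all add: field_simps)
  then have inv: "M 1 * M (- 1 / f 0) = 1\<^sub>m (n + 1)" "M (- 1 / f 0) * M 1 = 1\<^sub>m (n + 1)"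
    by (simp_all only: MM M0)
  have M_carr: "M p \<in> carrier_mat (n + 1) (n + 1)" for p by (simp add: M_def)
  have "invertible_mat (M 1)"
    unfolding invertible_mat_def inverts_mat_def using inv M_carr[of 1] M_carr[of "- 1 / f 0"]
    by (intro conjI exI[of _ "M (- 1 / f 0)"]) auto
  moreover have "rnc_vec n j 1 0 = M 1 *\<^sub>v v"
  proof (rule eq_vecI)
    fix i assume "i < dim_vec (M 1 *\<^sub>v v)"
    then have i: "i < n + 1" by (simp add: M_def)
    have "(M 1 *\<^sub>v v) $ i = (\<Sum>k<n + 1. ((if i = k then 1 else 0) + w i * f k) * v $ k)"
      using i v by (simp add: M_def scalar_prod_def atLeast0LessThan)
    also have "\<dots> = (\<Sum>k<n + 1. (if i = k then v $ k else 0) + w i * (f k * v $ k))"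
      by (intro sum.cong) (auto simp: algebra_simps)
    also have "\<dots> = v $ i + w i * (\<Sum>k<n + 1. f k * v $ k)"
      using i by (simp add: sum.distrib sum_distrib_left)
    also have "\<dots> = (if i = 0 then 1 else 0)" by (simp only: fv) (simp add: w_def)
    finally show "rnc_vec n j 1 0 $ i = (M 1 *\<^sub>v v) $ i"
      using i by (auto simp: rnc_vec_def power_0_left)
  qed (simp add: rnc_vec_def M_def)
  moreover have "v \<in> Q" by (rule normalized_at_mem[OF Q])
  ultimately show ?thesis
    unfolding in_Rnc_def using M_carr[of 1]
    by (intro bexI[of _ "M 1"] conjI ballI exI[of _ 1] exI[of _ 0]) auto
qed

text \<open>Over a finite field the product of all x - a, plus 1, is nonconstant and has the value 1
  everywhere.\<close>

lemma infinite_alg_closed_field: "infinite (UNIV :: 'a::alg_closed_field set)"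
proof
  assume fin: "finite (UNIV :: 'a set)"
  let ?p = "\<Prod>a\<in>(UNIV::'a set). [:- a, 1:]"
  have "degree ?p = card (UNIV :: 'a set)" by (subst degree_prod_sum_eq) auto
  then have deg: "degree ?p > 0" using fin by (simp add: card_gt_0_iff)
  then have "degree (?p + 1) > 0" by (subst degree_add_eq_left) auto
  then obtain x where "poly (?p + 1) x = 0" using alg_closed_imp_poly_has_root by blast
  moreover have "poly ?p x = 0" using fin by (auto simp: poly_prod)
  ultimately show False by simp
qed

theorem theorem3p3:
  fixes P :: "nat \<Rightarrow> 'a::alg_closed_field vec set"
    and m :: "nat \<Rightarrow> nat"
    and n s :: nat
  assumes "n \<ge> 1" and "s \<ge> 1"
    and "\<And>i. i \<in> {1..s} \<Longrightarrow> P i \<in> proj_space n"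
    and "inj_on P {1..s}"
    and "\<And>i. i \<in> {1..s} \<Longrightarrow> m i > 0"
  shows "int (fat_reg n s P m) \<ge> Max (rnc_bound n s P m ` {1..n})"
proof -
  have "\<exists>c. \<forall>i\<in>{1..s}. \<exists>v. normalized_at n (P i) (c i) v"
    using normalized_at_exists[OF assms(3)] by (intro bchoice) blast
  then obtain c where "\<forall>i\<in>{1..s}. \<exists>v. normalized_at n (P i) (c i) v" by blast
  from bchoice[OF this] obtain v where norm: "\<And>i. i \<in> {1..s} \<Longrightarrow> normalized_at n (P i) (c i) (v i)"
    by blast
  interpret fat_points n s P m c v
    by standard (use assms norm in auto)
  let ?t = "fat_reg n s P m"
  have "rnc_bound n s P m j \<le> int ?t" if j: "1 \<le> j" "j \<le> n" for j
  proof -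
    let ?b = "\<lambda>T. \<lfloor>(of_nat (\<Sum>i\<in>T. m i) + of_nat j - 2 :: rat) / of_nat j\<rfloor>"
    let ?S = "{?b T | T. T \<subseteq> {1..s} \<and> T \<noteq> {} \<and> in_Rnc n j (P ` T)}"
    have "?S \<subseteq> ?b ` Pow {1..s}" by blast
    then have "finite ?S" by (rule finite_subset) simp
    moreover have "?b {1} \<in> ?S"
      using single_point_in_Rnc[OF norm[of 1], of j] assms(2) by (intro CollectI exI[of _ "{1}"]) auto
    moreover have "x \<le> int ?t" if "x \<in> ?S" for x
    proof -
      obtain T where T: "x = ?b T" "T \<subseteq> {1..s}" "T \<noteq> {}" "in_Rnc n j (P ` T)"
        using \<open>x \<in> ?S\<close> by blast
      have "(\<Sum>i\<in>T. m i) \<le> ?t * j + 1"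
        using hilbert_fun_eq_iff hilbert_fun_fat_reg
        by (intro rnc_degree_bound[OF infinite_alg_closed_field j T(2-4)]) blast
      then have "(of_nat (\<Sum>i\<in>T. m i) :: rat) \<le> of_nat (?t * j + 1)" by (rule of_nat_mono)
      \<comment> \<open>The left side is at most t j + j - 1, one short of (t + 1) j; strictness is
        what the floor needs.\<close>
      then have "(of_nat (\<Sum>i\<in>T. m i) + of_nat j - 2 :: rat) < (of_nat ?t + 1) * of_nat j"
        by (simp add: algebra_simps del: of_nat_sum)
      then have "(of_nat (\<Sum>i\<in>T. m i) + of_nat j - 2 :: rat) / of_nat j < of_int (int ?t) + 1"
        using j by (simp add: pos_divide_less_eq del: of_nat_sum)
      then show ?thesis unfolding T(1) by (simp add: floor_le_iff)
    qed
    ultimately show ?thesis unfolding rnc_bound_def by (subst Max_le_iff) blast+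
  qed
  then show ?thesis using assms(1) by (subst Max_le_iff) auto
qed

end
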